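(* Let $T:=[T_1,\ldots,T_n]$, $T_i\in B(\mathcal H)$, be a row contraction. Then $$I-\Theta_T\Theta_T^*=K_TK_T^*,$$ where $\Theta_T$ is the characteristic function of $T$ and $K_T$ is the corresponding Poisson kernel.
   Context: Let $n\in\{1,2,\dots\}$ and let $F^2(H_n)=\bigoplus_{k\ge 0}H_n^{\otimes k}$ be the full Fock space of an $n$-dimensional complex Hilbert space $H_n$ with orthonormal basis $e_1,\dots,e_n$ (with $H_n^{\otimes 0}=\mathbb C1$); $R_i\varphi=\varphi\otimes e_i$ are the right creation operators. $\mathbb F_n^+$ is the unital free semigroup on $g_1,\dots,g_n$; for $\alpha=g_{i_1}\cdots g_{i_k}$, $T_\alpha=T_{i_1}\cdots T_{i_k}$ and $e_\alpha=e_{i_1}\otimes\cdots\otimes e_{i_k}$, with $T_{g_0}=I$ and $e_{g_0}=1$ for the neutral element $g_0$. $T=[T_1,\dots,T_n]$, viewed as an operator $\mathcal H^{(n)}\to\mathcal H$ ($\mathcal H^{(n)}$ the direct sum of $n$ copies of $\mathcal H$), is a row contraction if $TT^*=\sum_iT_iT_i^*\le I$. Set $\Delta_T=(I-TT^* )^{1/2}\in B(\mathcal H)$, $\Delta_{T^*}=(I-T^*T)^{1/2}\in B(\mathcal H^{(n)})$, $\mathcal D_T=\overline{\Delta_T\mathcal H}$, $\mathcal D_{T^*}=\overline{\Delta_{T^*}\mathcal H^{(n)}}$. The Poisson kernel $K_T:\mathcal H\to F^2(H_n)\otimes\mathcal D_T$ is $K_Th=\sum_{\alpha\in\mathbb F_n^+}e_\alpha\otimes\Delta_TT_\alpha^*h$.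 The characteristic function $\Theta_T:F^2(H_n)\otimes\mathcal D_{T^*}\to F^2(H_n)\otimes\mathcal D_T$ is the bounded operator (commuting with the left creation operators) with formal Fourier representation $$-I\otimes T+(I\otimes\Delta_T)\Big(I-\sum_{i=1}^nR_i\otimes T_i^*\Big)^{-1}[R_1\otimes I_{\mathcal H},\dots,R_n\otimes I_{\mathcal H}](I\otimes\Delta_{T^*}),$$ meaning that $\Theta_T$ is the SOT-limit as $r\to1$, $r<1$, of the operators obtained by replacing each $R_i$ by $rR_i$ in this formula (restricted to $F^2(H_n)\otimes\mathcal D_{T^*}$). *)

theory Defs
  imports "HOL-Analysis.Analysis"
begin

section \<open>Complex Hilbert spaces\<close>

text \<open>
  The norm and the topology of a complex Hilbert space are those of the underlying real Hilbert
  space, whose inner product is the real part of the complex one. The complex inner product is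
  linear in the first argument and conjugate-linear in the second.
\<close>

class chilbert_space = real_inner + complete_space +
  fixes scaleC :: "complex \<Rightarrow> 'a \<Rightarrow> 'a" (infixr \<open>*\<^sub>C\<close> 75)
    and cinner :: "'a \<Rightarrow> 'a \<Rightarrow> complex"
  assumes scaleC_add_right: "a *\<^sub>C (x + y) = a *\<^sub>C x + a *\<^sub>C y"
    and scaleC_add_left: "(a + b) *\<^sub>C x = a *\<^sub>C x + b *\<^sub>C x"
    and scaleC_scaleC: "a *\<^sub>C (b *\<^sub>C x) = (a * b) *\<^sub>C x"
    and scaleC_of_real: "complex_of_real r *\<^sub>C x = r *\<^sub>R x"
    and cinner_add_left: "cinner (x + y) z = cinner x z + cinner y z"
    and cinner_scaleC_left: "cinner (a *\<^sub>C x) y = a * cinner x y"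
    and cinner_commute: "cinner x y = cnj (cinner y x)"
    and Re_cinner: "Re (cinner x y) = inner x y"

instantiation complex :: chilbert_space
begin
definition scaleC_complex :: "complex \<Rightarrow> complex \<Rightarrow> complex" where
  "scaleC_complex a x = a * x"
definition cinner_complex :: "complex \<Rightarrow> complex \<Rightarrow> complex" where
  "cinner_complex x y = x * cnj y"
instance
  by standard (auto simp: scaleC_complex_def cinner_complex_def algebra_simps inner_complex_def
      scaleR_conv_of_real)
end

instantiation vec :: (chilbert_space, finite) chilbert_space
begin
definition scaleC_vec :: "complex \<Rightarrow> 'a ^ 'b \<Rightarrow> 'a ^ 'b" where
  "scaleC_vec a x = (\<chi> i. a *\<^sub>C x $ i)"
definition cinner_vec :: "'a ^ 'b \<Rightarrow> 'a ^ 'b \<Rightarrow> complex" where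
  "cinner_vec x y = (\<Sum>i\<in>UNIV. cinner (x $ i) (y $ i))"
instance
proof
  fix x y z :: "'a ^ 'b" and a b :: complex and r :: real
  show "a *\<^sub>C (x + y) = a *\<^sub>C x + a *\<^sub>C y"
    by (simp add: scaleC_vec_def vec_eq_iff scaleC_add_right)
  show "(a + b) *\<^sub>C x = a *\<^sub>C x + b *\<^sub>C x"
    by (simp add: scaleC_vec_def vec_eq_iff scaleC_add_left)
  show "a *\<^sub>C b *\<^sub>C x = (a * b) *\<^sub>C x"
    by (simp add: scaleC_vec_def vec_eq_iff scaleC_scaleC)
  show "complex_of_real r *\<^sub>C x = r *\<^sub>R x"
    by (simp add: scaleC_vec_def vec_eq_iff scaleC_of_real)
  show "cinner (x + y) z = cinner x z + cinner y z"
    by (simp add: cinner_vec_def cinner_add_left sum.distrib)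
  show "cinner (a *\<^sub>C x) y = a * cinner x y"
    by (simp add: scaleC_vec_def cinner_vec_def cinner_scaleC_left sum_distrib_left)
  show "cinner x y = cnj (cinner y x)"
    unfolding cinner_vec_def cnj_sum by (rule sum.cong[OF refl]) (rule cinner_commute)
  show "Re (cinner x y) = inner x y"
    by (simp add: cinner_vec_def inner_vec_def Re_cinner)
qed
end

lemma cinner_scaleC_right:
  fixes x :: "'a :: chilbert_space"
  shows "cinner x (a *\<^sub>C y) = cnj a * cinner x y"
  by (subst (1 2) cinner_commute) (simp add: cinner_scaleC_left)

lemma norm_scaleC:
  fixes x :: "'a :: chilbert_space"
  shows "norm (a *\<^sub>C x) = cmod a * norm x"
proof -
  have "cinner x x = complex_of_real (inner x x)"
    using cinner_commute[of x x] by (simp add: complex_eq_iff Re_cinner)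
  then have "cinner (a *\<^sub>C x) (a *\<^sub>C x) = complex_of_real ((cmod a)\<^sup>2 * inner x x)"
    by (simp add: cinner_scaleC_left cinner_scaleC_right mult_ac
        complex_norm_square[of a, unfolded of_real_power])
  then have "inner (a *\<^sub>C x) (a *\<^sub>C x) = (cmod a)\<^sup>2 * inner x x"
    by (metis Re_cinner Re_complex_of_real)
  then show ?thesis
    by (simp add: norm_eq_sqrt_inner real_sqrt_mult)
qed

lemma cmod_cinner_le:
  fixes x y :: "'a :: chilbert_space"
  shows "cmod (cinner x y) \<le> norm x * norm y"
proof (cases "cinner x y = 0")
  case False
  define u where "u = cnj (sgn (cinner x y))"
  have u: "cmod u = 1" using False by (simp add: u_def norm_sgn)
  have "cinner (u *\<^sub>C x) y = complex_of_real (cmod (cinner x y))"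
    using False complex_norm_square[of "cinner x y"]
    by (simp add: cinner_scaleC_left u_def sgn_eq power2_eq_square divide_simps mult.commute)
  then have "cmod (cinner x y) = inner (u *\<^sub>C x) y"
    by (metis Re_cinner Re_complex_of_real)
  also have "\<dots> \<le> norm (u *\<^sub>C x) * norm y" by (rule norm_cauchy_schwarz)
  finally show ?thesis by (simp add: norm_scaleC u)
qed simp

section \<open>Operators\<close>

definition bounded_clinear :: "('a::chilbert_space \<Rightarrow> 'b::chilbert_space) \<Rightarrow> bool" where
  "bounded_clinear A \<longleftrightarrow> bounded_linear A \<and> (\<forall>c x. A (c *\<^sub>C x) = c *\<^sub>C A x)"

text \<open>
  The adjoint of an operator whose domain is the closed subspace \<open>M\<close>; only the values of \<open>A\<close>
  on \<open>M\<close> matter. If \<open>A\<close> maps \<open>M\<close> into a closed subspace \<open>N\<close>, the adjoint of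
  \<open>A : M \<rightarrow> N\<close> is the restriction of this function to \<open>N\<close>.
\<close>
definition cadjoint_on :: "'a set \<Rightarrow> ('a::chilbert_space \<Rightarrow> 'b::chilbert_space) \<Rightarrow> 'b \<Rightarrow> 'a" where
  "cadjoint_on M A y = (THE x. x \<in> M \<and> (\<forall>z\<in>M. cinner (A z) y = cinner z x))"

abbreviation cadjoint :: "('a::chilbert_space \<Rightarrow> 'b::chilbert_space) \<Rightarrow> 'b \<Rightarrow> 'a" where
  "cadjoint \<equiv> cadjoint_on UNIV"

definition positive_op :: "('a::chilbert_space \<Rightarrow> 'a) \<Rightarrow> bool" where
  "positive_op A \<longleftrightarrow> bounded_clinear A \<and> (\<forall>x. cinner (A x) x \<in> \<real>\<^sub>\<ge>\<^sub>0)"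

definition op_le :: "('a::chilbert_space \<Rightarrow> 'a) \<Rightarrow> ('a \<Rightarrow> 'a) \<Rightarrow> bool" where
  "op_le A B \<longleftrightarrow> positive_op (\<lambda>x. B x - A x)"

definition sqrt_op :: "('a::chilbert_space \<Rightarrow> 'a) \<Rightarrow> 'a \<Rightarrow> 'a" where
  "sqrt_op A = (THE B. positive_op B \<and> B \<circ> B = A)"

section \<open>Square-summable families indexed by words\<close>

text \<open>
  Words in the free semigroup are lists over the finite index type \<open>'n\<close>. With the orthonormal
  basis \<open>e\<^sub>\<alpha>\<close> of the full Fock space, the Hilbert space tensor product of the full Fock space
  with \<open>\<H>\<close> is the space of square-summable families \<open>\<Sum>\<^sub>\<alpha> e\<^sub>\<alpha> \<otimes> f\<^sub>\<alpha>\<close>, \<open>f\<^sub>\<alpha> \<in> \<H>\<close>. The full Fock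
  space itself is the case \<open>\<H> = \<complex>\<close>; its summand of degree \<open>k\<close> consists of the families supported
  on words of length \<open>k\<close>.
\<close>

typedef (overloaded) ('n, 'a) fock =
  "{f :: 'n list \<Rightarrow> 'a::chilbert_space. (\<lambda>\<alpha>. (norm (f \<alpha>))\<^sup>2) summable_on UNIV}"
  morphisms fcoeff Abs_fock
  by (rule exI[of _ "\<lambda>_. 0"]) auto

setup_lifting type_definition_fock

lemma norm_add_sq_le:
  fixes x y :: "'a::real_normed_vector"
  shows "(norm (x + y))\<^sup>2 \<le> 2 * (norm x)\<^sup>2 + 2 * (norm y)\<^sup>2"
proof -
  have "(norm (x + y))\<^sup>2 \<le> (norm x + norm y)\<^sup>2"
    by (intro power_mono norm_triangle_ineq) auto
  also have "\<dots> \<le> 2 * (norm x)\<^sup>2 + 2 * (norm y)\<^sup>2"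
    using sum_squares_bound[of "norm x" "norm y"] by (simp add: power2_sum)
  finally show ?thesis .
qed

lemma sq_summable_add:
  fixes f g :: "'i \<Rightarrow> 'a::real_normed_vector"
  assumes "(\<lambda>i. (norm (f i))\<^sup>2) summable_on UNIV" "(\<lambda>i. (norm (g i))\<^sup>2) summable_on UNIV"
  shows "(\<lambda>i. (norm (f i + g i))\<^sup>2) summable_on UNIV"
proof (rule summable_on_comparison_test)
  show "(\<lambda>i. 2 * (norm (f i))\<^sup>2 + 2 * (norm (g i))\<^sup>2) summable_on UNIV"
    by (intro summable_on_add summable_on_cmult_right assms)
qed (auto simp: norm_add_sq_le)

lemma summable_cinner:
  fixes f g :: "'i \<Rightarrow> 'a::chilbert_space"
  assumes "(\<lambda>i. (norm (f i))\<^sup>2) summable_on UNIV" "(\<lambda>i. (norm (g i))\<^sup>2) summable_on UNIV"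
  shows "(\<lambda>i. cinner (f i) (g i)) summable_on UNIV"
proof (rule abs_summable_summable, rule summable_on_comparison_test)
  show "(\<lambda>i. (norm (f i))\<^sup>2 + (norm (g i))\<^sup>2) summable_on UNIV"
    by (intro summable_on_add assms)
  fix i
  have "cmod (cinner (f i) (g i)) \<le> norm (f i) * norm (g i)" by (rule cmod_cinner_le)
  also have "\<dots> \<le> (norm (f i))\<^sup>2 + (norm (g i))\<^sup>2"
    using sum_squares_bound[of "norm (f i)" "norm (g i)"]
      mult_nonneg_nonneg[OF norm_ge_zero[of "f i"] norm_ge_zero[of "g i"]]
    by linarith
  finally show "cmod (cinner (f i) (g i)) \<le> (norm (f i))\<^sup>2 + (norm (g i))\<^sup>2" .
qed auto

lemma has_sum_Re:
  assumes "(f has_sum s) A"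
  shows "((\<lambda>x. Re (f x)) has_sum Re s) A"
  using has_sum_bounded_linear[OF bounded_linear_Re assms] by (simp add: o_def)

lemma summable_inner:
  fixes f g :: "'i \<Rightarrow> 'a::chilbert_space"
  assumes "(\<lambda>i. (norm (f i))\<^sup>2) summable_on UNIV" "(\<lambda>i. (norm (g i))\<^sup>2) summable_on UNIV"
  shows "(\<lambda>i. inner (f i) (g i)) summable_on UNIV"
  using has_sum_imp_summable[OF has_sum_Re[OF has_sum_infsum[OF summable_cinner[OF assms]]]]
  unfolding Re_cinner .

lemma coeff_summable: "(\<lambda>\<alpha>. (norm (fcoeff f \<alpha>))\<^sup>2) summable_on UNIV"
  using fcoeff[of f] by auto

instantiation fock :: (type, chilbert_space) real_vector
begin

lift_definition zero_fock :: "('a, 'b) fock" is "\<lambda>_. 0" by simp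

lift_definition plus_fock :: "('a, 'b) fock \<Rightarrow> ('a, 'b) fock \<Rightarrow> ('a, 'b) fock"
  is "\<lambda>f g \<alpha>. f \<alpha> + g \<alpha>" by (rule sq_summable_add)

lift_definition uminus_fock :: "('a, 'b) fock \<Rightarrow> ('a, 'b) fock"
  is "\<lambda>f \<alpha>. - f \<alpha>" by simp

lift_definition minus_fock :: "('a, 'b) fock \<Rightarrow> ('a, 'b) fock \<Rightarrow> ('a, 'b) fock"
  is "\<lambda>f g \<alpha>. f \<alpha> - g \<alpha>"
  subgoal for f g using sq_summable_add[of f "\<lambda>\<alpha>. - g \<alpha>"] by simp
  done

lift_definition scaleR_fock :: "real \<Rightarrow> ('a, 'b) fock \<Rightarrow> ('a, 'b) fock"
  is "\<lambda>r f \<alpha>. r *\<^sub>R f \<alpha>" by (simp add: power_mult_distrib summable_on_cmult_right)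

instance
proof
  fix f g h :: "('a, 'b) fock" and r s :: real
  show "f + g + h = f + (g + h)" by transfer (simp add: add_ac)
  show "f + g = g + f" by transfer (simp add: add_ac)
  show "0 + f = f" by transfer simp
  show "- f + f = 0" by transfer simp
  show "f - g = f + - g" by transfer simp
  show "r *\<^sub>R (f + g) = r *\<^sub>R f + r *\<^sub>R g" by transfer (simp add: scaleR_add_right)
  show "(r + s) *\<^sub>R f = r *\<^sub>R f + s *\<^sub>R f" by transfer (simp add: scaleR_add_left)
  show "r *\<^sub>R s *\<^sub>R f = (r * s) *\<^sub>R f" by transfer simp
  show "1 *\<^sub>R f = f" by transfer simp
qed

end

instantiation fock :: (type, chilbert_space) real_inner
begin

definition inner_fock :: "('a, 'b) fock \<Rightarrow> ('a, 'b) fock \<Rightarrow> real" where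
  "inner_fock f g = (\<Sum>\<^sub>\<infinity>\<alpha>. inner (fcoeff f \<alpha>) (fcoeff g \<alpha>))"

definition norm_fock :: "('a, 'b) fock \<Rightarrow> real" where
  "norm_fock f = sqrt (inner f f)"

definition sgn_fock :: "('a, 'b) fock \<Rightarrow> ('a, 'b) fock" where
  "sgn_fock f = f /\<^sub>R norm f"

definition dist_fock :: "('a, 'b) fock \<Rightarrow> ('a, 'b) fock \<Rightarrow> real" where
  "dist_fock f g = norm (f - g)"

definition uniformity_fock :: "(('a, 'b) fock \<times> ('a, 'b) fock) filter" where
  "uniformity_fock = (INF e\<in>{0<..}. principal {(x, y). dist x y < e})"

definition open_fock :: "('a, 'b) fock set \<Rightarrow> bool" where
  "open_fock U = (\<forall>x\<in>U. \<forall>\<^sub>F (x', y) in uniformity. x' = x \<longrightarrow> y \<in> U)"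

instance
proof
  fix f g h :: "('a, 'b) fock" and r :: real
  note sm = summable_inner[OF coeff_summable coeff_summable]
  show "sgn f = f /\<^sub>R norm f" by (rule sgn_fock_def)
  show "dist f g = norm (f - g)" by (rule dist_fock_def)
  show "inner f g = inner g f" unfolding inner_fock_def by (simp add: inner_commute)
  show "inner (f + g) h = inner f h + inner g h"
    unfolding inner_fock_def plus_fock.rep_eq inner_add_left by (rule infsum_add[OF sm sm])
  show "inner (r *\<^sub>R f) g = r * inner f g"
    unfolding inner_fock_def scaleR_fock.rep_eq inner_scaleR_left
    by (rule infsum_cmult_right) (simp add: sm)
  show "0 \<le> inner f f" unfolding inner_fock_def by (rule infsum_nonneg) simp
  show "(inner f f = 0) = (f = 0)"
  proof
    assume "inner f f = 0"
    then have "inner (fcoeff f \<alpha>) (fcoeff f \<alpha>) = 0" for \<alpha>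
      unfolding inner_fock_def
      by (intro nonneg_infsum_le_0D[OF _ sm]) auto
    then show "f = 0" 
      by (simp add: zero_fock.rep_eq fun_eq_iff flip: fcoeff_inject)
  qed (simp add: inner_fock_def zero_fock.rep_eq)
  show "norm f = sqrt (inner f f)" by (rule norm_fock_def)
qed (simp_all add: uniformity_fock_def open_fock_def)

end

lemma norm_fock_sq: "(norm f)\<^sup>2 = (\<Sum>\<^sub>\<infinity>\<alpha>. (norm (fcoeff f \<alpha>))\<^sup>2)"
  by (simp add: power2_norm_eq_inner inner_fock_def)

lemma sum_coeff_le: "finite F \<Longrightarrow> (\<Sum>\<alpha>\<in>F. (norm (fcoeff f \<alpha>))\<^sup>2) \<le> (norm f)\<^sup>2"
  unfolding norm_fock_sq by (intro finite_sum_le_infsum coeff_summable) auto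

lemma norm_coeff_le: "norm (fcoeff f \<alpha>) \<le> norm f"
  by (rule power2_le_imp_le) (use sum_coeff_le[of "{\<alpha>}" f] in simp_all)

instance fock :: (type, chilbert_space) complete_space
proof
  fix X :: "nat \<Rightarrow> ('a, 'b) fock"
  assume X: "Cauchy X"
  have "Cauchy (\<lambda>n. fcoeff (X n) \<alpha>)" for \<alpha>
  proof (rule metric_CauchyI)
    fix e :: real assume "e > 0"
    then obtain N where N: "\<And>m n. m \<ge> N \<Longrightarrow> n \<ge> N \<Longrightarrow> norm (X m - X n) < e"
      using metric_CauchyD[OF X \<open>e > 0\<close>] unfolding dist_norm by blast
    show "\<exists>M. \<forall>m\<ge>M. \<forall>n\<ge>M. dist (fcoeff (X m) \<alpha>) (fcoeff (X n) \<alpha>) < e"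
    proof (intro exI allI impI)
      fix m n assume "m \<ge> N" "n \<ge> N"
      then show "dist (fcoeff (X m) \<alpha>) (fcoeff (X n) \<alpha>) < e"
        using N[of m n] norm_coeff_le[of "X m - X n" \<alpha>] by (simp add: minus_fock.rep_eq dist_norm)
    qed
  qed
  then have "\<forall>\<alpha>. \<exists>l. (\<lambda>n. fcoeff (X n) \<alpha>) \<longlonglongrightarrow> l"
    by (simp add: Cauchy_convergent_iff convergent_def)
  then obtain g where g: "\<And>\<alpha>. (\<lambda>n. fcoeff (X n) \<alpha>) \<longlonglongrightarrow> g \<alpha>" by metis
  have bound: "\<exists>N. \<forall>m\<ge>N. \<forall>F. finite F \<longrightarrow> (\<Sum>\<alpha>\<in>F. (norm (fcoeff (X m) \<alpha> - g \<alpha>))\<^sup>2) \<le> e\<^sup>2"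
    if e: "e > 0" for e :: real
  proof -
    obtain N where N: "\<And>m n. m \<ge> N \<Longrightarrow> n \<ge> N \<Longrightarrow> norm (X m - X n) < e"
      using metric_CauchyD[OF X e] unfolding dist_norm by blast
    have "(\<Sum>\<alpha>\<in>F. (norm (fcoeff (X m) \<alpha> - g \<alpha>))\<^sup>2) \<le> e\<^sup>2" if m: "m \<ge> N" and F: "finite F" for m F
    proof (rule tendsto_upperbound)
      show "(\<lambda>n. \<Sum>\<alpha>\<in>F. (norm (fcoeff (X m) \<alpha> - fcoeff (X n) \<alpha>))\<^sup>2)
          \<longlonglongrightarrow> (\<Sum>\<alpha>\<in>F. (norm (fcoeff (X m) \<alpha> - g \<alpha>))\<^sup>2)"
        by (intro tendsto_intros g)
      show "\<forall>\<^sub>F n in sequentially. (\<Sum>\<alpha>\<in>F. (norm (fcoeff (X m) \<alpha> - fcoeff (X n) \<alpha>))\<^sup>2) \<le> e\<^sup>2"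
        unfolding eventually_sequentially
      proof (intro exI allI impI)
        fix n assume "n \<ge> N"
        then have "(norm (X m - X n))\<^sup>2 \<le> e\<^sup>2"
          using N[OF m] by (intro power_mono) (auto intro: less_imp_le)
        then show "(\<Sum>\<alpha>\<in>F. (norm (fcoeff (X m) \<alpha> - fcoeff (X n) \<alpha>))\<^sup>2) \<le> e\<^sup>2"
          using sum_coeff_le[OF F, of "X m - X n"] by (simp add: minus_fock.rep_eq)
      qed
    qed simp
    then show ?thesis by blast
  qed
  have sq: "(\<lambda>\<alpha>. (norm (fcoeff (X m) \<alpha> - g \<alpha>))\<^sup>2) summable_on UNIV"
    if "\<forall>F. finite F \<longrightarrow> (\<Sum>\<alpha>\<in>F. (norm (fcoeff (X m) \<alpha> - g \<alpha>))\<^sup>2) \<le> c" for m c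
    by (rule nonneg_bdd_above_summable_on) (use that in \<open>auto intro!: bdd_aboveI[of _ c]\<close>)
  obtain N1 where N1: "\<forall>F. finite F \<longrightarrow> (\<Sum>\<alpha>\<in>F. (norm (fcoeff (X N1) \<alpha> - g \<alpha>))\<^sup>2) \<le> 1\<^sup>2"
    using bound[of 1] by auto
  define G where "G = Abs_fock g"
  have "(\<lambda>\<alpha>. (norm (fcoeff (X N1) \<alpha> + - (fcoeff (X N1) \<alpha> - g \<alpha>)))\<^sup>2) summable_on UNIV"
    by (rule sq_summable_add[OF coeff_summable]) (use sq[OF N1] in \<open>simp add: norm_minus_commute\<close>)
  then have G: "fcoeff G = g"
    unfolding G_def by (intro Abs_fock_inverse) simp
  have "X \<longlonglongrightarrow> G"
  proof (rule metric_LIMSEQ_I)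
    fix e :: real assume "e > 0"
    then obtain N where
      N: "\<forall>m\<ge>N. \<forall>F. finite F \<longrightarrow> (\<Sum>\<alpha>\<in>F. (norm (fcoeff (X m) \<alpha> - g \<alpha>))\<^sup>2) \<le> (e/2)\<^sup>2"
      using bound[of "e/2"] by auto
    have "dist (X m) G < e" if "m \<ge> N" for m
    proof -
      have "(norm (X m - G))\<^sup>2 \<le> (e/2)\<^sup>2"
        unfolding norm_fock_sq minus_fock.rep_eq G
        by (rule infsum_le_finite_sums) (use N that sq in auto)
      then have "norm (X m - G) \<le> e/2" by (rule power2_le_imp_le) (use \<open>e > 0\<close> in simp)
      then show ?thesis using \<open>e > 0\<close> by (simp add: dist_norm)
    qed
    then show "\<exists>N. \<forall>m\<ge>N. dist (X m) G < e" by blast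
  qed
  then show "convergent X" by (auto simp: convergent_def)
qed

instantiation fock :: (type, chilbert_space) chilbert_space
begin

lift_definition scaleC_fock :: "complex \<Rightarrow> ('a, 'b) fock \<Rightarrow> ('a, 'b) fock"
  is "\<lambda>c f \<alpha>. c *\<^sub>C f \<alpha>" by (simp add: norm_scaleC power_mult_distrib summable_on_cmult_right)

definition cinner_fock :: "('a, 'b) fock \<Rightarrow> ('a, 'b) fock \<Rightarrow> complex" where
  "cinner_fock f g = (\<Sum>\<^sub>\<infinity>\<alpha>. cinner (fcoeff f \<alpha>) (fcoeff g \<alpha>))"

instance
proof
  fix f g h :: "('a, 'b) fock" and a b :: complex and r :: real
  note sm = summable_cinner[OF coeff_summable coeff_summable]
  show "a *\<^sub>C (f + g) = a *\<^sub>C f + a *\<^sub>C g" by transfer (simp add: scaleC_add_right)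
  show "(a + b) *\<^sub>C f = a *\<^sub>C f + b *\<^sub>C f" by transfer (simp add: scaleC_add_left)
  show "a *\<^sub>C b *\<^sub>C f = (a * b) *\<^sub>C f" by transfer (simp add: scaleC_scaleC)
  show "complex_of_real r *\<^sub>C f = r *\<^sub>R f" by transfer (simp add: scaleC_of_real)
  show "cinner (f + g) h = cinner f h + cinner g h"
    unfolding cinner_fock_def plus_fock.rep_eq cinner_add_left by (rule infsum_add[OF sm sm])
  show "cinner (a *\<^sub>C f) g = a * cinner f g"
    unfolding cinner_fock_def scaleC_fock.rep_eq cinner_scaleC_left
    by (rule infsum_cmult_right) (simp add: sm)
  show "cinner f g = cnj (cinner g f)"
    unfolding cinner_fock_def infsum_cnj[symmetric]
    by (rule infsum_cong) (rule cinner_commute)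
  show "Re (cinner f g) = inner f g"
    using infsumI[OF has_sum_Re[OF has_sum_infsum[OF sm[of f g]]]]
    by (simp add: cinner_fock_def inner_fock_def Re_cinner)
qed

end

lift_definition tensor ::
  "('n, complex) fock \<Rightarrow> 'a::chilbert_space \<Rightarrow> ('n, 'a) fock" (infixr \<open>\<otimes>\<^sub>F\<close> 72)
  is "\<lambda>\<phi> h \<alpha>. \<phi> \<alpha> *\<^sub>C h"
  by (simp add: norm_scaleC power_mult_distrib summable_on_cmult_left)

lift_definition fock_basis :: "'n list \<Rightarrow> ('n, complex) fock"
  is "\<lambda>\<alpha> \<beta>. if \<beta> = \<alpha> then 1 else 0"
  subgoal for \<alpha>
    using summable_on_cong_neutral[of UNIV "{\<alpha>}"
        "\<lambda>\<beta>. (cmod (if \<beta> = \<alpha> then 1 else 0))\<^sup>2" "\<lambda>_. 1"]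
    by simp
  done

text \<open>
  The next two lemmas identify \<open>('n, 'a) fock\<close>, with \<open>\<otimes>\<^sub>F\<close>, as the Hilbert space tensor product.
\<close>

lemma cinner_tensor: "cinner (\<phi> \<otimes>\<^sub>F h) (\<psi> \<otimes>\<^sub>F k) = cinner \<phi> \<psi> * cinner h k"
proof -
  have "cinner (\<phi> \<otimes>\<^sub>F h) (\<psi> \<otimes>\<^sub>F k)
      = (\<Sum>\<^sub>\<infinity>\<alpha>. cinner (fcoeff \<phi> \<alpha>) (fcoeff \<psi> \<alpha>) * cinner h k)"
    by (simp add: cinner_fock_def tensor.rep_eq cinner_scaleC_left cinner_scaleC_right
        cinner_complex_def mult_ac)
  also have "\<dots> = cinner \<phi> \<psi> * cinner h k"
    unfolding cinner_fock_def
    by (rule infsum_cmult_left) (simp add: summable_cinner[OF coeff_summable coeff_summable])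
  finally show ?thesis .
qed

lemma has_sum_fock_expansion: "((\<lambda>\<alpha>. fock_basis \<alpha> \<otimes>\<^sub>F fcoeff f \<alpha>) has_sum f) UNIV"
proof -
  let ?S = "\<lambda>F. \<Sum>\<alpha>\<in>F. fock_basis \<alpha> \<otimes>\<^sub>F fcoeff f \<alpha>"
  let ?q = "\<lambda>F. \<Sum>\<alpha>\<in>F. (norm (fcoeff f \<alpha>))\<^sup>2"
  have c0: "0 *\<^sub>C x = 0" "1 *\<^sub>C x = x" for x :: 'b
    using scaleC_of_real[of 0 x] scaleC_of_real[of 1 x] by simp_all
  have coeff_sum: "fcoeff (?S F) \<beta> = (if \<beta> \<in> F then fcoeff f \<beta> else 0)" if "finite F" for F \<beta>
    using that
  proof (induction F rule: finite_induct)
    case empty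
    then show ?case by (simp add: zero_fock.rep_eq)
  next
    case (insert a F)
    then show ?case
      by (simp add: plus_fock.rep_eq tensor.rep_eq fock_basis.rep_eq c0)
  qed
  have norm_eq: "norm (?S F - f) = sqrt ((norm f)\<^sup>2 - ?q F)" if F: "finite F" for F
  proof -
    have d: "(norm (fcoeff (?S F - f) \<beta>))\<^sup>2
        = (norm (fcoeff f \<beta>))\<^sup>2 + - (if \<beta> \<in> F then (norm (fcoeff f \<beta>))\<^sup>2 else 0)" for \<beta>
      by (simp add: minus_fock.rep_eq coeff_sum[OF F])
    have "?q F = (\<Sum>\<alpha>\<in>F. if \<alpha> \<in> F then (norm (fcoeff f \<alpha>))\<^sup>2 else 0)"
      by (rule sum.cong) simp_all
    then have "((\<lambda>\<beta>. if \<beta> \<in> F then (norm (fcoeff f \<beta>))\<^sup>2 else 0) has_sum ?q F) F"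
      using has_sum_finite[OF F, of "\<lambda>\<alpha>. if \<alpha> \<in> F then (norm (fcoeff f \<alpha>))\<^sup>2 else 0"] by simp
    then have hs: "((\<lambda>\<beta>. if \<beta> \<in> F then (norm (fcoeff f \<beta>))\<^sup>2 else 0) has_sum ?q F) UNIV"
      by (rule has_sum_cong_neutral[THEN iffD1, rotated 3]) simp_all
    have "((\<lambda>\<beta>. (norm (fcoeff (?S F - f) \<beta>))\<^sup>2) has_sum ((norm f)\<^sup>2 + - ?q F)) UNIV"
      unfolding d norm_fock_sq
      by (rule has_sum_add[OF has_sum_infsum[OF coeff_summable] has_sum_uminusI[OF hs]])
    then have "(norm (?S F - f))\<^sup>2 = (norm f)\<^sup>2 - ?q F"
      unfolding norm_fock_sq[of "?S F - f"] by (simp add: infsumI)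
    then show ?thesis by (rule real_sqrt_unique[OF _ norm_ge_zero, symmetric])
  qed
  have "(?q \<longlongrightarrow> (norm f)\<^sup>2) (finite_subsets_at_top UNIV)"
    unfolding norm_fock_sq by (rule has_sum_infsum[OF coeff_summable, unfolded has_sum_def])
  then have "((\<lambda>F. sqrt ((norm f)\<^sup>2 - ?q F)) \<longlongrightarrow> sqrt ((norm f)\<^sup>2 - (norm f)\<^sup>2))
      (finite_subsets_at_top UNIV)"
    by (intro tendsto_real_sqrt tendsto_diff tendsto_const)
  moreover have "\<forall>\<^sub>F F in finite_subsets_at_top UNIV. sqrt ((norm f)\<^sup>2 - ?q F) = norm (?S F - f)"
    by (rule eventually_finite_subsets_at_top_weakI) (rule norm_eq[symmetric])
  ultimately have "((\<lambda>F. norm (?S F - f)) \<longlongrightarrow> sqrt ((norm f)\<^sup>2 - (norm f)\<^sup>2))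
      (finite_subsets_at_top UNIV)"
    by (rule Lim_transform_eventually)
  then have "((\<lambda>F. norm (?S F - f)) \<longlongrightarrow> 0) (finite_subsets_at_top UNIV)" by simp
  then have "((\<lambda>F. ?S F - f) \<longlongrightarrow> 0) (finite_subsets_at_top UNIV)"
    by (rule tendsto_norm_zero_cancel)
  then have "(?S \<longlongrightarrow> f) (finite_subsets_at_top UNIV)"
    by (rule LIM_zero_cancel)
  then show ?thesis unfolding has_sum_def .
qed

text \<open>The closed subspace \<open>F\<^sup>2(H\<^sub>n) \<otimes> D\<close> for a closed subspace \<open>D\<close>.\<close>
definition fock_over :: "'a set \<Rightarrow> ('n, 'a::chilbert_space) fock set" where
  "fock_over D = {f. \<forall>\<alpha>. fcoeff f \<alpha> \<in> D}"

text \<open>\<open>R\<^sub>i \<phi> = \<phi> \<otimes> e\<^sub>i\<close>, that is, \<open>R\<^sub>i\<close> sends \<open>e\<^sub>\<alpha>\<close> to \<open>e\<^bsub>\<alpha> g\<^sub>i\<^esub>\<close>.\<close>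
lift_definition right_creation :: "'n \<Rightarrow> ('n, complex) fock \<Rightarrow> ('n, complex) fock"
  is "\<lambda>i \<phi> \<beta>. if \<beta> \<noteq> [] \<and> last \<beta> = i then \<phi> (butlast \<beta>) else 0"
proof -
  fix i :: 'n and \<phi> :: "'n list \<Rightarrow> complex"
  let ?\<psi> = "\<lambda>\<beta>. if \<beta> \<noteq> [] \<and> last \<beta> = i then \<phi> (butlast \<beta>) else 0"
  assume "(\<lambda>\<alpha>. (norm (\<phi> \<alpha>))\<^sup>2) summable_on UNIV"
  then have "((\<lambda>\<beta>. (norm (?\<psi> \<beta>))\<^sup>2) \<circ> (\<lambda>\<alpha>. \<alpha> @ [i])) summable_on UNIV"
    by (simp add: o_def)
  then have "(\<lambda>\<beta>. (norm (?\<psi> \<beta>))\<^sup>2) summable_on range (\<lambda>\<alpha>. \<alpha> @ [i])"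
    by (subst summable_on_reindex) (auto simp: inj_on_def)
  moreover have "?\<psi> \<beta> = 0" if "\<beta> \<notin> range (\<lambda>\<alpha>. \<alpha> @ [i])" for \<beta>
    using that by (auto simp: image_iff) (metis append_butlast_last_id)
  ultimately show "(\<lambda>\<beta>. (norm (?\<psi> \<beta>))\<^sup>2) summable_on UNIV"
    by (subst summable_on_cong_neutral[where T = "range (\<lambda>\<alpha>. \<alpha> @ [i])"]) auto
qed

lemma right_creation_basis: "right_creation i (fock_basis \<alpha>) = fock_basis (\<alpha> @ [i])"
  by transfer (auto simp: fun_eq_iff)

text \<open>The operator \<open>A \<otimes> B\<close>, by its action \<open>\<Sum>\<^sub>\<alpha> e\<^sub>\<alpha> \<otimes> f\<^sub>\<alpha> \<mapsto> \<Sum>\<^sub>\<alpha> A e\<^sub>\<alpha> \<otimes> B f\<^sub>\<alpha>\<close>.\<close>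
definition tensor_op ::
  "(('n, complex) fock \<Rightarrow> ('n, complex) fock) \<Rightarrow> ('a::chilbert_space \<Rightarrow> 'b::chilbert_space) \<Rightarrow>
   ('n, 'a) fock \<Rightarrow> ('n, 'b) fock" (infixr \<open>\<otimes>\<^sub>O\<close> 72) where
  "(A \<otimes>\<^sub>O B) f = (\<Sum>\<^sub>\<infinity>\<alpha>. A (fock_basis \<alpha>) \<otimes>\<^sub>F B (fcoeff f \<alpha>))"

section \<open>Row contractions\<close>

text \<open>The row operator \<open>[A\<^sub>1, \<dots>, A\<^sub>n]\<close> on the direct sum of \<open>n\<close> copies; \<open>n\<close> is \<open>CARD('n) \<ge> 1\<close>.\<close>
definition row_op :: "('n::finite \<Rightarrow> 'a::chilbert_space \<Rightarrow> 'b::chilbert_space) \<Rightarrow> 'a ^ 'n \<Rightarrow> 'b" where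
  "row_op A h = (\<Sum>i\<in>UNIV. A i (h $ i))"

definition row_contraction :: "('n::finite \<Rightarrow> 'a::chilbert_space \<Rightarrow> 'a) \<Rightarrow> bool" where
  "row_contraction T \<longleftrightarrow>
     (\<forall>i. bounded_clinear (T i)) \<and> op_le (row_op T \<circ> cadjoint (row_op T)) id"

definition word_op :: "('n \<Rightarrow> 'a \<Rightarrow> 'a) \<Rightarrow> 'n list \<Rightarrow> 'a \<Rightarrow> 'a" where
  "word_op T \<alpha> = foldr (\<lambda>i A. T i \<circ> A) \<alpha> id"

definition defect :: "('n::finite \<Rightarrow> 'a::chilbert_space \<Rightarrow> 'a) \<Rightarrow> 'a \<Rightarrow> 'a" where
  "defect T = sqrt_op (\<lambda>h. h - row_op T (cadjoint (row_op T) h))"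

definition defect_star :: "('n::finite \<Rightarrow> 'a::chilbert_space \<Rightarrow> 'a) \<Rightarrow> 'a ^ 'n \<Rightarrow> 'a ^ 'n" where
  "defect_star T = sqrt_op (\<lambda>h. h - cadjoint (row_op T) (row_op T h))"

definition defect_space :: "('n::finite \<Rightarrow> 'a::chilbert_space \<Rightarrow> 'a) \<Rightarrow> 'a set" where
  "defect_space T = closure (range (defect T))"

definition defect_star_space :: "('n::finite \<Rightarrow> 'a::chilbert_space \<Rightarrow> 'a) \<Rightarrow> ('a ^ 'n) set" where
  "defect_star_space T = closure (range (defect_star T))"

definition poisson_kernel ::
  "('n::finite \<Rightarrow> 'a::chilbert_space \<Rightarrow> 'a) \<Rightarrow> 'a \<Rightarrow> ('n, 'a) fock" where
  "poisson_kernel T h = (\<Sum>\<^sub>\<infinity>\<alpha>. fock_basis \<alpha> \<otimes>\<^sub>F defect T (cadjoint (word_op T \<alpha>) h))"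

text \<open>The identification of \<open>F\<^sup>2(H\<^sub>n) \<otimes> \<H>\<^bsup>(n)\<^esup>\<close> with the direct sum of \<open>n\<close> copies of \<open>F\<^sup>2(H\<^sub>n) \<otimes> \<H>\<close>.\<close>
definition fock_split :: "('n::finite, 'a::chilbert_space ^ 'n) fock \<Rightarrow> ('n, 'a) fock ^ 'n" where
  "fock_split f = (\<chi> i. (id \<otimes>\<^sub>O (\<lambda>h. h $ i)) f)"

text \<open>The formula for the characteristic function with every \<open>R\<^sub>i\<close> replaced by \<open>r R\<^sub>i\<close>.\<close>
definition char_fun_r ::
  "('n::finite \<Rightarrow> 'a::chilbert_space \<Rightarrow> 'a) \<Rightarrow> real \<Rightarrow> ('n, 'a ^ 'n) fock \<Rightarrow> ('n, 'a) fock" where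
  "char_fun_r T r f =
     (let rR = (\<lambda>i \<phi>. r *\<^sub>R right_creation i \<phi>);
          resolvent = inv (\<lambda>g. g - (\<Sum>i\<in>UNIV. (rR i \<otimes>\<^sub>O cadjoint (T i)) g))
      in - (id \<otimes>\<^sub>O row_op T) f +
         (id \<otimes>\<^sub>O defect T)
           (resolvent (row_op (\<lambda>i. rR i \<otimes>\<^sub>O id) (fock_split ((id \<otimes>\<^sub>O defect_star T) f)))))"

text \<open>
  The limit in the strong operator topology. The characteristic function proper is the restriction
  of this function to \<open>fock_over (defect_star_space T)\<close>.
\<close>
definition char_fun ::
  "('n::finite \<Rightarrow> 'a::chilbert_space \<Rightarrow> 'a) \<Rightarrow> ('n, 'a ^ 'n) fock \<Rightarrow> ('n, 'a) fock" where
  "char_fun T f = Lim (at_left 1) (\<lambda>r. char_fun_r T r f)"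

definition char_fun_adj ::
  "('n::finite \<Rightarrow> 'a::chilbert_space \<Rightarrow> 'a) \<Rightarrow> ('n, 'a) fock \<Rightarrow> ('n, 'a ^ 'n) fock" where
  "char_fun_adj T = cadjoint_on (fock_over (defect_star_space T)) (char_fun T)"

end

theory Submission
  imports Defs
begin

text \<open>
  The block operator \<open>U (h, v) = (T\<^sup>* h + \<Delta>\<^bsub>T*\<^esub> v, \<Delta>\<^sub>T h - T v)\<close> from \<open>\<H> \<oplus> \<H>\<^bsup>(n)\<^esup>\<close> to
  \<open>\<H>\<^bsup>(n)\<^esup> \<oplus> \<H>\<close> is unitary. Read it as a linear system over the free semigroup: at the word \<open>\<alpha>\<close>,
  the state \<open>x\<^sub>\<alpha>\<close> and the input \<open>f\<^sub>\<alpha>\<close> produce the \<open>n\<close> states \<open>x\<^bsub>\<alpha>g\<^sub>i\<^esub>\<close> and the output \<open>y\<^sub>\<alpha>\<close>.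
  With initial state \<open>0\<close> the input-output map is \<open>\<Theta>\<^sub>T\<close>; with input \<open>0\<close> the map from the initial
  state to the output is \<open>K\<^sub>T\<close>. That \<open>U\<close> is isometric makes both contractive. Since \<open>U\<^sup>*\<close> is
  isometric as well, the system started at \<open>K\<^sub>T\<^sup>* y\<close> with input \<open>\<Theta>\<^sub>T\<^sup>* y\<close> has output \<open>y\<close>, and by
  linearity \<open>y = K\<^sub>T K\<^sub>T\<^sup>* y + \<Theta>\<^sub>T \<Theta>\<^sub>T\<^sup>* y\<close>. Replacing \<open>R\<^sub>i\<close> by \<open>r R\<^sub>i\<close> damps the transitions by
  \<open>r\<close>, which conjugates \<open>\<Theta>\<^sub>T\<close> with \<open>e\<^sub>\<alpha> \<mapsto> r\<^bsup>|\<alpha>|\<^esup> e\<^sub>\<alpha>\<close>; this gives the limit as \<open>r \<rightarrow> 1\<close>.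
\<close>

section \<open>Adjoints\<close>

lemma Im_cinner: "Im (cinner x y) = - inner (\<i> *\<^sub>C x) y"
  by (simp add: Re_cinner[symmetric] cinner_scaleC_left)

lemma inner_scaleC_left: "inner (c *\<^sub>C x) y = inner x (cnj c *\<^sub>C y)"
  by (simp add: Re_cinner[symmetric] cinner_scaleC_left cinner_scaleC_right)

lemma bounded_linear_scaleC: "bounded_linear (\<lambda>x. c *\<^sub>C x)"
proof (rule bounded_linear_intro)
  show "c *\<^sub>C (r *\<^sub>R x) = r *\<^sub>R (c *\<^sub>C x)" for r and x :: 'a
    by (simp add: scaleC_of_real[symmetric] scaleC_scaleC mult.commute)
qed (auto simp: scaleC_add_right norm_scaleC mult.commute[of "cmod c"])

lemma scaleC_simps [simp]:
  "c *\<^sub>C (0::'a::chilbert_space) = 0" "0 *\<^sub>C (x::'a) = 0" "1 *\<^sub>C x = x"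
  using linear_0[OF bounded_linear.linear[OF bounded_linear_scaleC[of c, where 'a='a]]]
    scaleC_of_real[of 0 x] scaleC_of_real[of 1 x]
  by simp_all

lemma bounded_clinear_linear: "bounded_clinear A \<Longrightarrow> linear A"
  by (simp add: bounded_clinear_def bounded_linear.linear)

lemma bounded_clinear_bounded_linear: "bounded_clinear A \<Longrightarrow> bounded_linear A"
  by (simp add: bounded_clinear_def)

lemma bounded_clinear_scaleC: "bounded_clinear A \<Longrightarrow> A (c *\<^sub>C x) = c *\<^sub>C A x"
  by (simp add: bounded_clinear_def)

lemma bounded_clinearI:
  assumes "linear A" "\<And>x. norm (A x) \<le> K * norm x" "\<And>c x. A (c *\<^sub>C x) = c *\<^sub>C A x"
  shows "bounded_clinear A"
  unfolding bounded_clinear_def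
  using assms linear_add[OF assms(1)] linear_scale[OF assms(1)]
  by (auto intro!: bounded_linear_intro[of _ K] simp: mult.commute[of _ K])

text \<open>Up to sign, the imaginary part of \<open>cinner x y\<close> is the real inner product of
  \<i> x with y, so real identities at z and at \<i> z give the complex one. Adjoints can thus be
  computed with \<open>inner\<close>.\<close>

lemma cinner_adjointI:
  assumes "A (\<i> *\<^sub>C z) = \<i> *\<^sub>C A z"
    and "inner (A z) y = inner z x" "inner (A (\<i> *\<^sub>C z)) y = inner (\<i> *\<^sub>C z) x"
  shows "cinner (A z) y = cinner z x"
  using assms by (simp add: complex_eq_iff Re_cinner Im_cinner)

text \<open>The representing vector minimises \<open>\<parallel>x\<parallel>\<^sup>2 / 2 - f x\<close>; the parallelogram law makes minimising
  sequences Cauchy.\<close>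
lemma riesz_representation:
  fixes f :: "'a::{real_inner, complete_space} \<Rightarrow> real"
  assumes "bounded_linear f"
  obtains y where "\<And>x. f x = inner x y"
proof -
  interpret f: bounded_linear f by fact
  define J where "J x = (norm x)\<^sup>2 / 2 - f x" for x
  obtain K where K: "\<And>x. norm (f x) \<le> norm x * K" using f.bounded by blast
  have lower: "- K\<^sup>2 / 2 \<le> J x" for x
  proof -
    have "f x \<le> norm x * K" using K[of x] by auto
    moreover have "0 \<le> (norm x - K)\<^sup>2" by simp
    ultimately show ?thesis by (simp add: J_def power2_diff)
  qed
  define m where "m = Inf (range J)"
  have bdd: "bdd_below (range J)" using lower by (intro bdd_belowI2)
  have m: "m \<le> J x" for x unfolding m_def by (rule cInf_lower[OF rangeI bdd])
  have "\<exists>x. J x < m + inverse (real (Suc n))" for n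
    using cInf_lessD[of "range J" "m + inverse (real (Suc n))"] by (auto simp: m_def)
  then obtain X where X: "\<And>n. J (X n) < m + inverse (real (Suc n))" by metis
  have par: "(norm (x - y))\<^sup>2 = 4 * J x + 4 * J y - 8 * J ((1/2) *\<^sub>R (x + y))" for x y
    by (simp add: J_def power2_norm_eq_inner f.add f.scaleR inner_diff inner_add inner_commute
        power_divide field_simps)
  have "Cauchy X"
  proof (rule metric_CauchyI)
    fix e :: real assume e: "e > 0"
    \<comment> \<open>By \<open>par\<close>, with J at least m at the midpoint, the squared distance
      is below 4/(i+1) + 4/(j+1); the factor 8 makes this less than e^2.\<close>
    obtain N where N: "inverse (real (Suc N)) < e\<^sup>2 / 8"
      using reals_Archimedean[of "e\<^sup>2 / 8"] e by auto
    show "\<exists>M. \<forall>i\<ge>M. \<forall>j\<ge>M. dist (X i) (X j) < e"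
    proof (intro exI allI impI)
      fix i j assume "i \<ge> N" "j \<ge> N"
      then have "inverse (real (Suc i)) \<le> inverse (real (Suc N))"
        "inverse (real (Suc j)) \<le> inverse (real (Suc N))" by (auto simp: field_simps)
      then have "(norm (X i - X j))\<^sup>2 < e\<^sup>2"
        using par[of "X i" "X j"] X[of i] X[of j] m[of "(1/2) *\<^sub>R (X i + X j)"] N by linarith
      then show "dist (X i) (X j) < e"
        unfolding dist_norm using e power2_less_imp_less[of "norm (X i - X j)" e] by simp
    qed
  qed
  then obtain y where y: "X \<longlonglongrightarrow> y" using Cauchy_convergent convergent_def by blast
  have "(\<lambda>n. J (X n)) \<longlonglongrightarrow> J y"
    unfolding J_def by (intro tendsto_intros f.tendsto y) auto
  moreover have "(\<lambda>n. m + inverse (real (Suc n))) \<longlonglongrightarrow> m + 0"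
    by (intro tendsto_intros LIMSEQ_inverse_real_of_nat)
  ultimately have "J y \<le> m"
    using LIMSEQ_le[of "\<lambda>n. J (X n)" "J y" "\<lambda>n. m + inverse (real (Suc n))" "m + 0"] X
    by (auto intro: less_imp_le)
  then have min: "J y \<le> J x" for x using m[of x] by simp
  have "f x = inner x y" for x
  proof (cases "x = 0")
    case False
    define d where "d = f x - inner x y"
    \<comment> \<open>The minimiser in t of the increment of J along x. The increment there is - d^2
      / (2 |x|^2), so minimality of y forces d = 0.\<close>
    define t where "t = d / inner x x"
    have pos: "inner x x > 0" using False by simp
    have "0 \<le> J (y + t *\<^sub>R x) - J y" using min by simp
    also have "\<dots> = t\<^sup>2 * inner x x / 2 - t * d"
      unfolding J_def d_def power2_norm_eq_inner
      by (simp add: f.add f.scaleR inner_add inner_commute field_simps power2_eq_square)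
    also have "\<dots> = - (d\<^sup>2 / (2 * inner x x))"
      using pos by (simp add: t_def power2_eq_square field_simps)
    finally have "d\<^sup>2 \<le> 0" using pos by (simp add: divide_le_0_iff)
    then show ?thesis by (simp add: d_def)
  qed (simp add: f.zero)
  then show thesis by (rule that)
qed

text \<open>Uniqueness in the definite description: the difference of two candidates lies in M and
  serves as the test vector.\<close>

lemma cadjoint_on_eqI:
  assumes "x \<in> M" "\<And>z. z \<in> M \<Longrightarrow> cinner (A z) y = cinner z x"
    and M: "\<And>u v. u \<in> M \<Longrightarrow> v \<in> M \<Longrightarrow> u - v \<in> M"
  shows "cadjoint_on M A y = x"
  unfolding cadjoint_on_def
proof (rule the_equality)
  fix x' assume x': "x' \<in> M \<and> (\<forall>z\<in>M. cinner (A z) y = cinner z x')"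
  then have "cinner (x' - x) x' = cinner (x' - x) x"
    using M[of x' x] assms(1) assms(2)[of "x' - x"] by simp
  then have "inner (x' - x) x' = inner (x' - x) x" by (simp add: Re_cinner[symmetric])
  then have "inner (x' - x) (x' - x) = 0" by (simp add: inner_diff_right)
  then show "x' = x" by simp
qed (use assms in auto)

text \<open>The Riesz representation of the real functional z \<mapsto> \<open>inner (A z) y\<close>
  supplies the vector that \<open>cadjoint\<close> describes; complex linearity of A upgrades the
  real identity.\<close>

lemma cinner_cadjoint:
  assumes "bounded_clinear A"
  shows "cinner (A z) y = cinner z (cadjoint A y)"
proof -
  have bl: "bounded_linear (\<lambda>z. inner (A z) y)"
    by (rule bounded_linear_compose[OF bounded_linear_inner_left
          bounded_clinear_bounded_linear[OF assms]])
  obtain x where x: "\<And>z. inner (A z) y = inner z x"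
    using riesz_representation[OF bl] by metis
  have *: "cinner (A z) y = cinner z x" for z
    by (rule cinner_adjointI[OF bounded_clinear_scaleC[OF assms] x x])
  have "cadjoint A y = x" by (rule cadjoint_on_eqI[OF _ *]) auto
  then show ?thesis using * by simp
qed

lemma inner_cadjoint:
  assumes "bounded_clinear A"
  shows "inner (A z) y = inner z (cadjoint A y)"
  using cinner_cadjoint[OF assms, of z y] by (metis Re_cinner)

lemma eq_if_inner_eq:
  fixes x y :: "'a::real_inner"
  assumes "\<And>z. inner z x = inner z y"
  shows "x = y"
  using assms[of "x - y"] inner_eq_zero_iff[of "x - y"] by (simp add: inner_diff_right)

lemma cadjoint_eqI:
  assumes "bounded_clinear A" "\<And>z. inner (A z) y = inner z x"
  shows "cadjoint A y = x"
  using assms(2) inner_cadjoint[OF assms(1)] by (metis eq_if_inner_eq)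

lemma norm_cadjoint_le:
  assumes A: "bounded_clinear A" and K: "\<And>x. norm (A x) \<le> K * norm x" "0 \<le> K"
  shows "norm (cadjoint A y) \<le> K * norm y"
proof (cases "cadjoint A y = 0")
  case False
  have "norm (cadjoint A y) * norm (cadjoint A y) = inner (A (cadjoint A y)) y"
    by (simp add: inner_cadjoint[OF A] power2_norm_eq_inner flip: power2_eq_square)
  also have "\<dots> \<le> norm (A (cadjoint A y)) * norm y" by (rule norm_cauchy_schwarz)
  also have "\<dots> \<le> (K * norm (cadjoint A y)) * norm y" by (intro mult_right_mono K) auto
  finally show ?thesis using False by (simp add: mult.assoc mult.left_commute[of K])
qed (use K in auto)

lemma bounded_clinear_cadjoint:
  assumes A: "bounded_clinear A"
  shows "bounded_clinear (cadjoint A)"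
proof -
  obtain K where K: "0 \<le> K" "\<And>x. norm (A x) \<le> norm x * K"
    using bounded_linear.nonneg_bounded[OF bounded_clinear_bounded_linear[OF A]] by blast
  note A_lin = bounded_clinear_linear[OF A]
  show ?thesis
  proof (rule bounded_clinearI)
    show "norm (cadjoint A y) \<le> K * norm y" for y
      by (rule norm_cadjoint_le[OF A]) (use K in \<open>simp_all add: mult.commute\<close>)
    show "linear (cadjoint A)"
      by (intro linearI cadjoint_eqI[OF A])
        (simp_all add: inner_add_right inner_cadjoint[OF A])
    show "cadjoint A (c *\<^sub>C y) = c *\<^sub>C cadjoint A y" for c y
    proof (rule cadjoint_eqI[OF A])
      fix z
      have "inner (A z) (c *\<^sub>C y) = inner (A (cnj c *\<^sub>C z)) y"
        by (simp add: bounded_clinear_scaleC[OF A] inner_scaleC_left)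
      then show "inner (A z) (c *\<^sub>C y) = inner z (c *\<^sub>C cadjoint A y)"
        by (simp add: inner_cadjoint[OF A] inner_scaleC_left)
    qed
  qed
qed

section \<open>Square roots of positive operators\<close>

text \<open>Successive approximation for Y = (C + Y^2)/2. A solution satisfies (I - Y)^2 = I - C, so
  I - Y is a square root of I - C.\<close>

primrec sqrt_iter :: "('a::real_vector \<Rightarrow> 'a) \<Rightarrow> nat \<Rightarrow> 'a \<Rightarrow> 'a" where
  "sqrt_iter C 0 x = 0"
| "sqrt_iter C (Suc n) x = (1/2) *\<^sub>R (C x + sqrt_iter C n (sqrt_iter C n x))"

text \<open>The same iteration for the scalar C = 1, which stays below its fixed point 1. It
  controls the norms and the increments of the operator iterates, so its convergence yields
  theirs.\<close>

primrec sqrt_majorant :: "nat \<Rightarrow> real" where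
  "sqrt_majorant 0 = 0"
| "sqrt_majorant (Suc n) = (1 + (sqrt_majorant n)\<^sup>2) / 2"

lemma sqrt_majorant_bounds: "0 \<le> sqrt_majorant n" "sqrt_majorant n \<le> 1"
proof (induction n)
  case (Suc n)
  { case 1 show ?case by simp }
  { case 2 show ?case using Suc power_le_one[of "sqrt_majorant n" 2] by simp }
qed auto

lemma incseq_sqrt_majorant: "incseq sqrt_majorant"
proof (rule incseq_SucI)
  fix n
  have "0 \<le> (sqrt_majorant n - 1)\<^sup>2" by simp
  then show "sqrt_majorant n \<le> sqrt_majorant (Suc n)" by (simp add: power2_diff)
qed

lemma linear_sqrt_iter: "linear C \<Longrightarrow> linear (sqrt_iter C n)"
proof (induction n)
  case 0 show ?case by (simp add: linear_iff)
next
  case (Suc n)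
  then show ?case by (simp add: linear_iff scaleR_add_right)
qed

text \<open>Each iterate is a polynomial in its operator, so the relation X C = D X passes to all of
  them.\<close>

lemma sqrt_iter_intertwine:
  assumes "linear X" "\<And>x. X (C x) = D (X x)"
  shows "X (sqrt_iter C n x) = sqrt_iter D n (X x)"
  by (induction n arbitrary: x)
    (simp_all add: assms(2) linear_0[OF assms(1)] linear_add[OF assms(1)]
      linear_scale[OF assms(1)])

locale sqrt_setup =
  fixes C :: "'a::chilbert_space \<Rightarrow> 'a"
  assumes clin: "bounded_clinear C"
    and contr: "norm (C x) \<le> norm x"
    and self_adjoint: "inner (C x) y = inner x (C y)"
begin

abbreviation "Y \<equiv> sqrt_iter C"
abbreviation "\<eta> \<equiv> sqrt_majorant"

lemmas linear_Y = linear_sqrt_iter[OF bounded_clinear_linear[OF clin]]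

lemma norm_Y_le: "norm (Y n x) \<le> \<eta> n * norm x"
proof (induction n arbitrary: x)
  case (Suc n)
  have "norm (C x + Y n (Y n x)) \<le> norm x + \<eta> n * (\<eta> n * norm x)"
    by (rule norm_triangle_le)
      (intro add_mono contr order_trans[OF Suc mult_left_mono[OF Suc]] sqrt_majorant_bounds)
  then show ?case
    unfolding sqrt_iter.simps sqrt_majorant.simps norm_scaleR
    by (simp add: power2_eq_square algebra_simps)
qed simp

lemma norm_Y_le1: "norm (Y n x) \<le> norm x"
  by (rule order_trans[OF norm_Y_le]) (simp add: sqrt_majorant_bounds mult_left_le_one_le)

text \<open>The operator increments are dominated by those of the scalar iteration, because
  \<open>Y\<^sub>n\<^sup>2 - Y\<^sub>m\<^sup>2 = Y\<^sub>n (Y\<^sub>n - Y\<^sub>m) + (Y\<^sub>n - Y\<^sub>m) Y\<^sub>m\<close>.\<close>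
lemma norm_Y_diff_Suc: "norm (Y (Suc n) x - Y n x) \<le> (\<eta> (Suc n) - \<eta> n) * norm x"
proof (induction n arbitrary: x)
  case 0 show ?case using contr[of x] by simp
next
  case (Suc n)
  let ?d = "\<eta> (Suc n) - \<eta> n"
  have d: "0 \<le> ?d" using incseq_SucD[OF incseq_sqrt_majorant] by simp
  have "norm (Y (Suc n) (Y (Suc n) x) - Y n (Y n x))
      = norm (Y (Suc n) (Y (Suc n) x - Y n x) + (Y (Suc n) (Y n x) - Y n (Y n x)))"
    by (simp only: linear_diff[OF linear_Y]) simp
  also have "\<dots> \<le> \<eta> (Suc n) * (?d * norm x) + ?d * (\<eta> n * norm x)"
  proof (rule norm_triangle_le, rule add_mono)
    show "norm (Y (Suc n) (Y (Suc n) x - Y n x)) \<le> \<eta> (Suc n) * (?d * norm x)"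
      by (rule order_trans[OF norm_Y_le mult_left_mono[OF Suc]]) (rule sqrt_majorant_bounds)
    show "norm (Y (Suc n) (Y n x) - Y n (Y n x)) \<le> ?d * (\<eta> n * norm x)"
      by (rule order_trans[OF Suc mult_left_mono[OF norm_Y_le d]])
  qed
  finally have "norm ((1/2) *\<^sub>R (Y (Suc n) (Y (Suc n) x) - Y n (Y n x)))
      \<le> (1/2) * (\<eta> (Suc n) * (?d * norm x) + ?d * (\<eta> n * norm x))"
    unfolding norm_scaleR by simp
  also have "\<dots> = (\<eta> (Suc (Suc n)) - \<eta> (Suc n)) * norm x"
  proof -
    have *: "(1/2) * (a * ((a - b) * c) + (a - b) * (b * c)) = ((1 + a\<^sup>2) / 2 - (1 + b\<^sup>2) / 2) * c"
      for a b c :: real by (simp add: power2_eq_square field_simps)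
    show ?thesis
      unfolding * sqrt_majorant.simps(2)[symmetric] ..
  qed
  also have "(1/2) *\<^sub>R (Y (Suc n) (Y (Suc n) x) - Y n (Y n x)) = Y (Suc (Suc n)) x - Y (Suc n) x"
    by (simp only: sqrt_iter.simps scaleR_diff_right[symmetric] add_diff_cancel_left)
  finally show ?case .
qed

lemma norm_Y_diff: "m \<le> n \<Longrightarrow> norm (Y n x - Y m x) \<le> (\<eta> n - \<eta> m) * norm x"
proof (induction n rule: dec_induct)
  case (step n)
  have "norm (Y (Suc n) x - Y m x) \<le> norm (Y (Suc n) x - Y n x) + norm (Y n x - Y m x)"
    using norm_triangle_ineq[of "Y (Suc n) x - Y n x" "Y n x - Y m x"] by simp
  also have "\<dots> \<le> (\<eta> (Suc n) - \<eta> n) * norm x + (\<eta> n - \<eta> m) * norm x"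
    by (rule add_mono[OF norm_Y_diff_Suc step.IH])
  finally show ?case by (simp add: left_diff_distrib)
qed simp

lemma convergent_Y: "convergent (\<lambda>n. Y n x)"
proof -
  have "convergent \<eta>"
    by (rule Bseq_mono_convergent[OF BseqI'[of _ 1]])
      (use sqrt_majorant_bounds incseqD[OF incseq_sqrt_majorant] in auto)
  then have "Cauchy (\<lambda>n. \<eta> n * norm x)"
    by (intro convergent_Cauchy convergent_mult convergent_const)
  have "Cauchy (\<lambda>n. Y n x)"
  proof (rule metric_CauchyI)
    fix e :: real assume "e > 0"
    then obtain N where N: "\<And>m n. m \<ge> N \<Longrightarrow> n \<ge> N \<Longrightarrow> dist (\<eta> m * norm x) (\<eta> n * norm x) < e"
      using metric_CauchyD[OF \<open>Cauchy (\<lambda>n. \<eta> n * norm x)\<close>] by blast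
    have "dist (Y m x) (Y n x) < e" if "m \<ge> N" "n \<ge> N" "m \<le> n" for m n
      using N[OF that(1,2)] norm_Y_diff[OF that(3), of x]
      by (simp add: dist_norm norm_minus_commute left_diff_distrib abs_le_iff)
    then show "\<exists>M. \<forall>m\<ge>M. \<forall>n\<ge>M. dist (Y m x) (Y n x) < e"
      by (metis dist_commute linorder_linear)
  qed
  then show ?thesis by (rule Cauchy_convergent)
qed

definition L :: "'a \<Rightarrow> 'a" where "L x = lim (\<lambda>n. Y n x)"

definition S :: "'a \<Rightarrow> 'a" where "S x = x - L x"

lemma Y_tendsto: "(\<lambda>n. Y n x) \<longlonglongrightarrow> L x"
  using convergent_Y by (simp add: L_def convergent_LIMSEQ_iff)

lemma linear_L: "linear L"
proof (rule linearI)
  show "L (x + y) = L x + L y" for x y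
    by (rule LIMSEQ_unique[OF Y_tendsto])
      (simp add: linear_add[OF linear_Y] tendsto_add Y_tendsto)
  show "L (r *\<^sub>R x) = r *\<^sub>R L x" for r x
    by (rule LIMSEQ_unique[OF Y_tendsto])
      (simp add: linear_scale[OF linear_Y] tendsto_scaleR Y_tendsto)
qed

lemma norm_L_le: "norm (L x) \<le> norm x"
  by (rule LIMSEQ_le_const2[OF tendsto_norm[OF Y_tendsto]]) (auto simp: norm_Y_le1)

lemma L_scaleC: "L (c *\<^sub>C x) = c *\<^sub>C L x"
proof (rule LIMSEQ_unique[OF Y_tendsto])
  have "Y n (c *\<^sub>C x) = c *\<^sub>C Y n x" for n
    by (rule sqrt_iter_intertwine[where X = "\<lambda>x. c *\<^sub>C x" and C = C and D = C, symmetric])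
      (simp_all add: bounded_linear.linear[OF bounded_linear_scaleC] bounded_clinear_scaleC[OF clin])
  then show "(\<lambda>n. Y n (c *\<^sub>C x)) \<longlonglongrightarrow> c *\<^sub>C L x"
    by (simp add: bounded_linear.tendsto[OF bounded_linear_scaleC Y_tendsto])
qed

lemma bounded_clinear_S: "bounded_clinear S"
proof (rule bounded_clinearI)
  show "linear S"
    unfolding S_def by (intro linear_compose_sub linear_ident linear_L)
  show "norm (S x) \<le> 2 * norm x" for x
    unfolding S_def using norm_triangle_ineq4[of x "L x"] norm_L_le[of x] by simp
  show "S (c *\<^sub>C x) = c *\<^sub>C S x" for c x
    unfolding S_def L_scaleC
    using linear_diff[OF bounded_linear.linear[OF bounded_linear_scaleC[of c]]] by metis
qed

lemma Y_self_adjoint: "inner (Y n x) y = inner x (Y n y)"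
  by (induction n arbitrary: x y)
    (simp_all add: inner_add_left inner_add_right self_adjoint)

lemma S_self_adjoint: "inner (S x) y = inner x (S y)"
proof -
  have "inner (L x) y = inner x (L y)"
    by (rule LIMSEQ_unique[of "\<lambda>n. inner (Y n x) y"])
      (intro tendsto_intros Y_tendsto, simp only: Y_self_adjoint, intro tendsto_intros Y_tendsto)
  then show ?thesis by (simp add: S_def inner_diff_left inner_diff_right)
qed

text \<open>Passing to the limit in the recursion gives L = (C + L^2)/2. For the quadratic term,
  \<open>Y n (Y n x) - L (L x)\<close> is split as \<open>Y n (Y n x - L x)\<close> plus
  \<open>Y n (L x) - L (L x)\<close>; contractivity of \<open>Y n\<close> handles the first summand,
  pointwise convergence the second.\<close>

lemma S_S: "S (S x) = x - C x"
proof -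
  have "(\<lambda>n. norm (Y n (Y n x - L x)) + norm (Y n (L x) - L (L x))) \<longlonglongrightarrow> 0 + 0"
  proof (rule tendsto_add)
    have 1: "(\<lambda>n. norm (Y n x - L x)) \<longlonglongrightarrow> 0"
      by (intro tendsto_norm_zero LIM_zero Y_tendsto)
    show "(\<lambda>n. norm (Y n (Y n x - L x))) \<longlonglongrightarrow> 0"
      by (rule tendsto_sandwich[OF _ _ tendsto_const 1]) (auto simp: norm_Y_le1)
    show "(\<lambda>n. norm (Y n (L x) - L (L x))) \<longlonglongrightarrow> 0"
      by (intro tendsto_norm_zero LIM_zero Y_tendsto)
  qed
  then have lim: "(\<lambda>n. norm (Y n (Y n x - L x)) + norm (Y n (L x) - L (L x))) \<longlonglongrightarrow> 0"
    by simp
  have "norm (Y n (Y n x) - L (L x)) \<le> norm (Y n (Y n x - L x)) + norm (Y n (L x) - L (L x))" for n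
    using norm_triangle_ineq[of "Y n (Y n x - L x)" "Y n (L x) - L (L x)"]
    by (simp add: linear_diff[OF linear_Y])
  then have "(\<lambda>n. norm (Y n (Y n x) - L (L x))) \<longlonglongrightarrow> 0"
    by (intro tendsto_sandwich[OF _ _ tendsto_const lim]) auto
  then have YY: "(\<lambda>n. Y n (Y n x)) \<longlonglongrightarrow> L (L x)"
    by (rule LIM_zero_cancel[OF tendsto_norm_zero_cancel])
  have "(\<lambda>n. Y (Suc n) x) \<longlonglongrightarrow> (1/2) *\<^sub>R (C x + L (L x))"
    unfolding sqrt_iter.simps by (intro tendsto_intros YY)
  then have "L x = (1/2) *\<^sub>R (C x + L (L x))"
    by (rule LIMSEQ_unique[OF LIMSEQ_Suc[OF Y_tendsto]])
  then have "2 *\<^sub>R L x = 2 *\<^sub>R ((1/2) *\<^sub>R (C x + L (L x)))" by (rule arg_cong)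
  then have "L (L x) = 2 *\<^sub>R L x - C x" by simp
  then show ?thesis by (simp add: S_def linear_diff[OF linear_L] scaleR_2)
qed

lemma positive_S: "positive_op S"
  unfolding positive_op_def
proof (intro conjI allI bounded_clinear_S)
  fix x
  have "inner (L x) x \<le> norm x * norm x"
    by (rule order_trans[OF norm_cauchy_schwarz mult_right_mono[OF norm_L_le]]) simp
  then have "0 \<le> inner (S x) x"
    by (simp add: S_def inner_diff_left power2_norm_eq_inner flip: power2_eq_square)
  moreover have "cinner (S x) x = cinner x (S x)"
    by (rule cinner_adjointI)
      (rule bounded_clinear_scaleC[OF bounded_clinear_S] S_self_adjoint)+
  then have "Im (cinner (S x) x) = 0"
    using cinner_commute[of x "S x"] by (simp add: complex_eq_iff)
  ultimately show "cinner (S x) x \<in> \<real>\<^sub>\<ge>\<^sub>0"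
    by (simp add: complex_nonneg_Reals_iff Re_cinner)
qed

end

section \<open>Positive operators and uniqueness of the square root\<close>

lemma positive_op_nonneg: "positive_op A \<Longrightarrow> 0 \<le> inner (A x) x"
  unfolding positive_op_def by (metis Re_cinner complex_nonneg_Reals_iff)

text \<open>The quadratic form being real suffices: polarize with \<open>x + y\<close> and \<open>\<i> x + y\<close>.\<close>
lemma positive_op_self_adjoint:
  assumes "positive_op A"
  shows "inner (A x) y = inner x (A y)"
proof -
  have A: "bounded_clinear A" and "\<And>x. cinner (A x) x \<in> \<real>\<^sub>\<ge>\<^sub>0"
    using assms by (auto simp: positive_op_def)
  then have re: "inner (\<i> *\<^sub>C A x) x = 0" for x
    using Im_cinner[of "A x" x] by (metis complex_nonneg_Reals_iff neg_equal_0_iff_equal)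
  have pol: "inner (\<i> *\<^sub>C A x) y + inner (\<i> *\<^sub>C A y) x = 0" for x y
    using re[of "x + y"] re[of x] re[of y]
    by (simp add: linear_add[OF bounded_clinear_linear[OF A]] scaleC_add_right inner_add)
  have "inner (\<i> *\<^sub>C A (\<i> *\<^sub>C x)) y + inner (\<i> *\<^sub>C A y) (\<i> *\<^sub>C x) = 0" by (rule pol)
  then have "inner (\<i> *\<^sub>C A y) (\<i> *\<^sub>C x) = inner (A x) y"
    by (simp add: bounded_clinear_scaleC[OF A] scaleC_scaleC
        scaleC_of_real[of "-1", simplified])
  then show ?thesis
    by (simp add: inner_scaleC_left scaleC_scaleC inner_commute)
qed

text \<open>Positivity at x - t A x reads 0 \<le> t^2 b - 2 t a with a = |A x|^2, which fails for
  small t > 0 unless a = 0.\<close>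

lemma positive_op_eq_0:
  assumes A: "positive_op A" and 0: "inner (A x) x = 0"
  shows "A x = 0"
proof (rule ccontr)
  assume ne: "A x \<noteq> 0"
  have lin: "linear A" using A by (simp add: positive_op_def bounded_clinear_linear)
  define a where "a = inner (A x) (A x)"
  define b where "b = inner (A (A x)) (A x)"
  have a: "a > 0" using ne by (simp add: a_def)
  have b: "b \<ge> 0" using positive_op_nonneg[OF A] by (simp add: b_def)
  \<comment> \<open>Small enough that t b \<le> a; the summand 1 covers the case b = 0.\<close>
  define t where "t = a / (b + 1)"
  have "0 \<le> inner (A (x - t *\<^sub>R A x)) (x - t *\<^sub>R A x)" by (rule positive_op_nonneg[OF A])
  also have "\<dots> = t * (t * b - 2 * a)"
    using 0 positive_op_self_adjoint[OF A, of "A x" x]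
    by (simp add: linear_diff[OF lin] linear_scale[OF lin] inner_diff_left inner_diff_right
        a_def b_def algebra_simps)
  finally have "0 \<le> t * (t * b - 2 * a)" .
  moreover have "t > 0" using a b by (simp add: t_def)
  ultimately have "2 * a \<le> t * b" by (simp add: zero_le_mult_iff)
  moreover have "t * b \<le> a" using a b by (simp add: t_def field_simps)
  ultimately show False using a by simp
qed

context sqrt_setup
begin

text \<open>A competing root B commutes with C, hence with the iterates and with S. Then (S + B)(S -
  B) = 0, so S and B, both positive, annihilate y = (S - B) x, and self-adjointness gives |y|^2 =
  0.\<close>

lemma sqrt_op_eq: "sqrt_op (\<lambda>x. x - C x) = S"
  unfolding sqrt_op_def
proof (rule the_equality)
  show "positive_op S \<and> S \<circ> S = (\<lambda>x. x - C x)" by (auto simp: positive_S S_S)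
  fix B assume B: "positive_op B \<and> B \<circ> B = (\<lambda>x. x - C x)"
  then have BB: "B (B x) = x - C x" for x by (metis comp_apply)
  have lin: "linear B" using B by (simp add: positive_op_def bounded_clinear_linear)
  have linS: "linear S" by (rule bounded_clinear_linear[OF bounded_clinear_S])
  have blinB: "bounded_linear B"
    using B by (simp add: positive_op_def bounded_clinear_bounded_linear)
  \<comment> \<open>B^3 equals both B (I - C) and (I - C) B.\<close>
  have BC: "B (C x) = C (B x)" for x
  proof -
    have "B (B (B x)) = B x - B (C x)" unfolding BB[of x] by (rule linear_diff[OF lin])
    then show ?thesis using BB[of "B x"] by simp
  qed
  have "B (L x) = L (B x)" for x
    using bounded_linear.tendsto[OF blinB Y_tendsto[of x]] Y_tendsto[of "B x"]
    by (simp add: sqrt_iter_intertwine[where X = B and C = C and D = C, OF lin BC] LIMSEQ_unique)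
  then have BS: "B (S x) = S (B x)" for x by (simp add: S_def linear_diff[OF lin])
  have "S x = B x" for x
  proof -
    define y where "y = S x - B x"
    have "S y + B y = 0"
      by (simp add: y_def linear_diff[OF lin] linear_diff[OF linS] BS BB S_S)
    then have "inner (S y) y + inner (B y) y = 0" by (simp add: inner_add_left[symmetric])
    then have "inner (S y) y = 0" "inner (B y) y = 0"
      using positive_op_nonneg[of S y] positive_op_nonneg[of B y] positive_S B by auto
    then have "S y = 0" "B y = 0" using positive_op_eq_0 positive_S B by blast+
    then have "inner (S x - B x) y = 0"
      using S_self_adjoint[of x y] positive_op_self_adjoint[of B x y] B by (simp add: inner_diff_left)
    then show ?thesis by (simp add: y_def)
  qed
  then show "B = S" by auto
qed

end

text \<open>The relation survives the limit of the iterates. It is what makes a row contraction and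
  its adjoint intertwine the two defect operators.\<close>

lemma sqrt_setup_intertwine:
  assumes "sqrt_setup C" "sqrt_setup D" "bounded_linear X" "\<And>x. X (C x) = D (X x)"
  shows "X (sqrt_setup.S C x) = sqrt_setup.S D (X x)"
proof -
  note lin = bounded_linear.linear[OF assms(3)]
  have "(\<lambda>n. X (sqrt_iter C n x)) \<longlonglongrightarrow> X (sqrt_setup.L C x)"
    by (rule bounded_linear.tendsto[OF assms(3) sqrt_setup.Y_tendsto[OF assms(1)]])
  then have "(\<lambda>n. sqrt_iter D n (X x)) \<longlonglongrightarrow> X (sqrt_setup.L C x)"
    by (simp add: sqrt_iter_intertwine[where X = X and C = C and D = D, OF lin assms(4)])
  then have "X (sqrt_setup.L C x) = sqrt_setup.L D (X x)"
    using sqrt_setup.Y_tendsto[OF assms(2)] LIMSEQ_unique by blast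
  then show ?thesis
    by (simp add: sqrt_setup.S_def[OF assms(1)] sqrt_setup.S_def[OF assms(2)] linear_diff[OF lin])
qed

section \<open>Coefficients on the Fock space\<close>

lemmas fcoeff_simps [simp] =
  zero_fock.rep_eq plus_fock.rep_eq minus_fock.rep_eq uminus_fock.rep_eq scaleR_fock.rep_eq
  scaleC_fock.rep_eq

lemma fock_eqI: "(\<And>\<alpha>. fcoeff f \<alpha> = fcoeff g \<alpha>) \<Longrightarrow> f = g"
  by (simp add: fcoeff_inject[symmetric] fun_eq_iff)

lemma fcoeff_sum [simp]: "fcoeff (sum f I) \<alpha> = (\<Sum>i\<in>I. fcoeff (f i) \<alpha>)"
  by (induction I rule: infinite_finite_induct) simp_all

lemma fcoeff_Abs_fock:
  "(\<lambda>\<alpha>. (norm (g \<alpha>))\<^sup>2) summable_on UNIV \<Longrightarrow> fcoeff (Abs_fock g) = g"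
  by (simp add: Abs_fock_inverse)

text \<open>Sums over all words are limits of sums over these finite sets, which split by the first
  or the last letter and so permit induction on the length.\<close>

definition words_upto :: "nat \<Rightarrow> 'n list set" where
  "words_upto N = {\<alpha>. length \<alpha> \<le> N}"

lemma finite_words_upto [simp]: "finite (words_upto N :: 'n::finite list set)"
  using finite_lists_length_le[of "UNIV :: 'n set" N] by (simp add: words_upto_def)

lemma words_upto_mono: "M \<le> N \<Longrightarrow> words_upto M \<subseteq> words_upto N"
  by (auto simp: words_upto_def)

lemma finite_subset_words_upto: "finite F \<Longrightarrow> \<exists>N. F \<subseteq> words_upto N"
proof (induction F rule: finite_induct)
  case (insert a F)
  then obtain N where "F \<subseteq> words_upto N" by blast
  then have "insert a F \<subseteq> words_upto (max N (length a))"
    using words_upto_mono[of N "max N (length a)"] by (auto simp: words_upto_def)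
  then show ?case by blast
qed simp

lemma words_upto_0: "words_upto 0 = {[]}"
  by (auto simp: words_upto_def)

lemma sum_words_upto_Cons:
  fixes f :: "'n::finite list \<Rightarrow> 'b::comm_monoid_add"
  shows "sum f (words_upto (Suc N)) = f [] + (\<Sum>i\<in>UNIV. \<Sum>\<alpha>\<in>words_upto N. f (i # \<alpha>))"
proof -
  have eq: "(words_upto (Suc N) :: 'n list set) = insert [] (\<Union>i\<in>UNIV. (#) i ` words_upto N)" (is "_ = insert [] ?U")
  proof (intro set_eqI)
    fix \<alpha> :: "'n list"
    show "\<alpha> \<in> words_upto (Suc N) \<longleftrightarrow> \<alpha> \<in> insert [] ?U"
      by (cases \<alpha>) (auto simp: words_upto_def)
  qed
  have "sum f ?U = (\<Sum>i\<in>UNIV. sum f ((#) i ` words_upto N))"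
    by (rule sum.UNION_disjoint) auto
  also have "\<dots> = (\<Sum>i\<in>UNIV. \<Sum>\<alpha>\<in>words_upto N. f (i # \<alpha>))"
    by (simp add: sum.reindex)
  finally show ?thesis unfolding eq by (subst sum.insert) auto
qed

text \<open>Reversal permutes \<open>words_upto\<close> and turns the last letter into the
  first.\<close>

lemma sum_words_upto_snoc:
  fixes f :: "'n::finite list \<Rightarrow> 'b::comm_monoid_add"
  shows "sum f (words_upto (Suc N)) = f [] + (\<Sum>\<alpha>\<in>words_upto N. \<Sum>i\<in>UNIV. f (\<alpha> @ [i]))"
proof -
  have rev: "sum g (words_upto M) = (\<Sum>\<alpha>\<in>words_upto M. g (rev \<alpha>))"
    for g :: "'n list \<Rightarrow> 'b" and M
    by (rule sum.reindex_bij_witness[of _ rev rev]) (auto simp: words_upto_def)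
  have "sum f (words_upto (Suc N)) = (\<Sum>\<alpha>\<in>words_upto (Suc N). f (rev \<alpha>))" by (rule rev)
  also have "\<dots> = f [] + (\<Sum>i\<in>UNIV. \<Sum>\<alpha>\<in>words_upto N. f (rev \<alpha> @ [i]))"
    by (simp add: sum_words_upto_Cons)
  also have "(\<Sum>i\<in>UNIV. \<Sum>\<alpha>\<in>words_upto N. f (rev \<alpha> @ [i]))
      = (\<Sum>i\<in>UNIV. \<Sum>\<alpha>\<in>words_upto N. f (\<alpha> @ [i]))"
    by (intro sum.cong refl rev[of "\<lambda>\<alpha>. f (\<alpha> @ [_])", symmetric])
  also have "\<dots> = (\<Sum>\<alpha>\<in>words_upto N. \<Sum>i\<in>UNIV. f (\<alpha> @ [i]))"
    by (rule sum.swap)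
  finally show ?thesis .
qed

lemma sum_norm_fcoeff_le:
  fixes f :: "('n::finite, 'a::chilbert_space) fock"
  shows "(\<Sum>\<alpha>\<in>words_upto N. (norm (fcoeff f \<alpha>))\<^sup>2) \<le> (norm f)\<^sup>2"
  by (rule sum_coeff_le) simp

lemma fock_bounded_summable:
  fixes g :: "'n::finite list \<Rightarrow> 'a::chilbert_space"
  assumes "\<And>N. (\<Sum>\<alpha>\<in>words_upto N. (norm (g \<alpha>))\<^sup>2) \<le> b"
  shows "(\<lambda>\<alpha>. (norm (g \<alpha>))\<^sup>2) summable_on UNIV" "(\<Sum>\<^sub>\<infinity>\<alpha>. (norm (g \<alpha>))\<^sup>2) \<le> b"
proof -
  have le: "(\<Sum>\<alpha>\<in>F. (norm (g \<alpha>))\<^sup>2) \<le> b" if F: "finite F" for F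
  proof -
    obtain N where "F \<subseteq> words_upto N" using finite_subset_words_upto[OF F] by blast
    then have "(\<Sum>\<alpha>\<in>F. (norm (g \<alpha>))\<^sup>2) \<le> (\<Sum>\<alpha>\<in>words_upto N. (norm (g \<alpha>))\<^sup>2)"
      by (intro sum_mono2) auto
    then show ?thesis using assms by (rule order_trans)
  qed
  then show sm: "(\<lambda>\<alpha>. (norm (g \<alpha>))\<^sup>2) summable_on UNIV"
    by (intro nonneg_bdd_above_summable_on) (auto intro!: bdd_aboveI2)
  show "(\<Sum>\<^sub>\<infinity>\<alpha>. (norm (g \<alpha>))\<^sup>2) \<le> b"
    by (rule infsum_le_finite_sums[OF sm le])
qed

lemma norm_fock_leI:
  fixes f :: "('n::finite, 'a::chilbert_space) fock"
  assumes "\<And>N. (\<Sum>\<alpha>\<in>words_upto N. (norm (fcoeff f \<alpha>))\<^sup>2) \<le> b"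
  shows "(norm f)\<^sup>2 \<le> b"
  unfolding norm_fock_sq using assms by (rule fock_bounded_summable)

lemma filterlim_words_upto:
  "filterlim (words_upto :: nat \<Rightarrow> 'n::finite list set) (finite_subsets_at_top UNIV) sequentially"
  unfolding filterlim_finite_subsets_at_top
proof safe
  fix X :: "'n list set" assume "finite X"
  then obtain N where "X \<subseteq> words_upto N" using finite_subset_words_upto by blast
  then have "X \<subseteq> words_upto M" if "M \<ge> N" for M using words_upto_mono[OF that] by blast
  then show "\<forall>\<^sub>F N in sequentially. finite (words_upto N :: 'n list set) \<and> X \<subseteq> words_upto N
      \<and> words_upto N \<subseteq> UNIV"
    unfolding eventually_sequentially by auto
qed

lemma inner_fock_LIMSEQ:
  fixes f g :: "('n::finite, 'a::chilbert_space) fock"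
  shows "(\<lambda>N. \<Sum>\<alpha>\<in>words_upto N. inner (fcoeff f \<alpha>) (fcoeff g \<alpha>)) \<longlonglongrightarrow> inner f g"
  unfolding inner_fock_def
  by (rule filterlim_compose[OF _ filterlim_words_upto])
    (use has_sum_infsum[OF summable_inner[OF coeff_summable[of f] coeff_summable[of g]]]
      in \<open>simp add: has_sum_def\<close>)

text \<open>The adjoint of the left creation operator \<open>\<phi> \<mapsto> e\<^sub>\<beta> \<otimes> \<phi>\<close>.\<close>
lift_definition left_cut :: "'n list \<Rightarrow> ('n, 'a::chilbert_space) fock \<Rightarrow> ('n, 'a) fock"
  is "\<lambda>\<beta> f \<alpha>. f (\<beta> @ \<alpha>)"
proof -
  fix \<beta> :: "'n list" and f :: "'n list \<Rightarrow> 'a"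
  assume "(\<lambda>\<alpha>. (norm (f \<alpha>))\<^sup>2) summable_on UNIV"
  then have "(\<lambda>\<alpha>. (norm (f \<alpha>))\<^sup>2) summable_on range ((@) \<beta>)"
    by (rule summable_on_subset_banach) simp
  then show "(\<lambda>\<alpha>. (norm (f (\<beta> @ \<alpha>)))\<^sup>2) summable_on UNIV"
    by (subst (asm) summable_on_reindex) (auto simp: inj_on_def o_def)
qed

declare left_cut.rep_eq [simp]

lemma left_cut_left_cut: "left_cut \<alpha> (left_cut \<beta> f) = left_cut (\<beta> @ \<alpha>) f"
  by (rule fock_eqI) simp

lemma left_cut_Nil [simp]: "left_cut [] f = f"
  by (rule fock_eqI) simp

lemma inner_fock_Cons:
  fixes f g :: "('n::finite, 'a::chilbert_space) fock"
  shows "inner f g = inner (fcoeff f []) (fcoeff g [])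
    + (\<Sum>i\<in>UNIV. inner (left_cut [i] f) (left_cut [i] g))"
proof (rule LIMSEQ_unique[OF LIMSEQ_Suc[OF inner_fock_LIMSEQ[of f g]]])
  have "(\<lambda>N. inner (fcoeff f []) (fcoeff g []) + (\<Sum>i\<in>UNIV. \<Sum>\<alpha>\<in>words_upto N.
        inner (fcoeff (left_cut [i] f) \<alpha>) (fcoeff (left_cut [i] g) \<alpha>)))
    \<longlonglongrightarrow> inner (fcoeff f []) (fcoeff g []) + (\<Sum>i\<in>UNIV. inner (left_cut [i] f) (left_cut [i] g))"
    by (intro tendsto_intros inner_fock_LIMSEQ)
  then show "(\<lambda>N. \<Sum>\<alpha>\<in>words_upto (Suc N). inner (fcoeff f \<alpha>) (fcoeff g \<alpha>))
    \<longlonglongrightarrow> inner (fcoeff f []) (fcoeff g []) + (\<Sum>i\<in>UNIV. inner (left_cut [i] f) (left_cut [i] g))"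
    by (simp add: sum_words_upto_Cons)
qed

text \<open>The hypothesis says that f is the image of \<open>left_cut \<beta> f\<close> under left
  creation by \<beta>, so this is the adjointness of creation and cut. It is proved one letter at a
  time.\<close>

lemma inner_left_cut:
  fixes f g :: "('n::finite, 'a::chilbert_space) fock"
  assumes "\<And>\<alpha>. (\<nexists>\<gamma>. \<alpha> = \<beta> @ \<gamma>) \<Longrightarrow> fcoeff f \<alpha> = 0"
  shows "inner f g = inner (left_cut \<beta> f) (left_cut \<beta> g)"
  using assms
proof (induction \<beta> arbitrary: f g)
  case (Cons i \<beta>)
  have 0: "left_cut [j] f = 0" if "j \<noteq> i" for j
    using that by (intro fock_eqI) (auto intro: Cons.prems)
  have "inner f g = (\<Sum>j\<in>UNIV. inner (left_cut [j] f) (left_cut [j] g))"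
    unfolding inner_fock_Cons[of f g] by (subst Cons.prems) auto
  also have "\<dots> = (\<Sum>j\<in>UNIV. if j = i then inner (left_cut [i] f) (left_cut [i] g) else 0)"
    by (rule sum.cong) (auto simp: 0)
  also have "\<dots> = inner (left_cut \<beta> (left_cut [i] f)) (left_cut \<beta> (left_cut [i] g))"
    by (simp, rule Cons.IH, simp, rule Cons.prems) auto
  finally show ?case by (simp add: left_cut_left_cut)
qed simp

lift_definition single_fock :: "'n list \<Rightarrow> 'a::chilbert_space \<Rightarrow> ('n, 'a) fock"
  is "\<lambda>\<beta> v \<alpha>. if \<alpha> = \<beta> then v else 0"
  by (subst summable_on_cong_neutral[where T = "{_}" and g = "\<lambda>_. (norm _)\<^sup>2"]) auto

declare single_fock.rep_eq [simp]

lemma left_cut_single_fock: "left_cut \<beta> (single_fock \<beta> v) = single_fock [] v"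
  by (rule fock_eqI) simp

lemma inner_single_fock:
  fixes f :: "('n::finite, 'a::chilbert_space) fock"
  shows "inner (single_fock \<beta> v) f = inner v (fcoeff f \<beta>)"
proof -
  have 0: "left_cut [i] (single_fock [] v) = 0" for i
    by (rule fock_eqI) simp
  have "inner (single_fock \<beta> v) f = inner (single_fock [] v) (left_cut \<beta> f)"
    by (subst inner_left_cut[of \<beta>]) (auto simp: left_cut_single_fock)
  also have "\<dots> = inner v (fcoeff f \<beta>)"
    by (simp add: inner_fock_Cons[of "single_fock [] v"] 0)
  finally show ?thesis .
qed

section \<open>The operators in the formula for the characteristic function\<close>

text \<open>The operator I \<otimes> X in coefficient form, meaningful for bounded X; it replaces
  the infinite sum in \<open>tensor_op\<close>.\<close>

definition map_fock ::
  "('a::chilbert_space \<Rightarrow> 'b::chilbert_space) \<Rightarrow> ('n, 'a) fock \<Rightarrow> ('n, 'b) fock" where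
  "map_fock X f = Abs_fock (\<lambda>\<alpha>. X (fcoeff f \<alpha>))"

lemma fcoeff_map_fock:
  assumes "bounded_linear X"
  shows "fcoeff (map_fock X f) \<alpha> = X (fcoeff f \<alpha>)"
proof -
  obtain K where K: "\<And>x. norm (X x) \<le> norm x * K"
    using bounded_linear.bounded[OF assms] by blast
  have "(\<lambda>\<alpha>. (norm (X (fcoeff f \<alpha>)))\<^sup>2) summable_on UNIV"
  proof (rule summable_on_comparison_test)
    show "(\<lambda>\<alpha>. (norm (fcoeff f \<alpha>))\<^sup>2 * K\<^sup>2) summable_on UNIV"
      by (intro summable_on_cmult_left coeff_summable)
    show "(norm (X (fcoeff f \<alpha>)))\<^sup>2 \<le> (norm (fcoeff f \<alpha>))\<^sup>2 * K\<^sup>2" for \<alpha>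
      using power_mono[OF K norm_ge_zero, of _ 2] by (simp add: power_mult_distrib)
  qed simp
  then show ?thesis by (simp add: map_fock_def fcoeff_Abs_fock)
qed

lemma tensor_op_id:
  assumes "bounded_linear X"
  shows "(id \<otimes>\<^sub>O X) f = map_fock X f"
  using has_sum_fock_expansion[of "map_fock X f"]
  by (simp add: tensor_op_def fcoeff_map_fock[OF assms] infsumI)

text \<open>The operator R_i \<otimes> I; \<open>right_creation\<close> covers only scalar
  coefficients.\<close>

lift_definition right_shift :: "'n \<Rightarrow> ('n, 'a::chilbert_space) fock \<Rightarrow> ('n, 'a) fock"
  is "\<lambda>i f \<beta>. if \<beta> \<noteq> [] \<and> last \<beta> = i then f (butlast \<beta>) else 0"
proof -
  fix i :: 'n and f :: "'n list \<Rightarrow> 'a"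
  let ?g = "\<lambda>\<beta>. if \<beta> \<noteq> [] \<and> last \<beta> = i then f (butlast \<beta>) else 0"
  assume "(\<lambda>\<alpha>. (norm (f \<alpha>))\<^sup>2) summable_on UNIV"
  then have "((\<lambda>\<beta>. (norm (?g \<beta>))\<^sup>2) \<circ> (\<lambda>\<alpha>. \<alpha> @ [i])) summable_on UNIV"
    by (simp add: o_def)
  then have "(\<lambda>\<beta>. (norm (?g \<beta>))\<^sup>2) summable_on range (\<lambda>\<alpha>. \<alpha> @ [i])"
    by (subst summable_on_reindex) (auto simp: inj_on_def)
  moreover have "?g \<beta> = 0" if "\<beta> \<notin> range (\<lambda>\<alpha>. \<alpha> @ [i])" for \<beta>
    using that by (metis append_butlast_last_id rangeI)
  ultimately show "(\<lambda>\<beta>. (norm (?g \<beta>))\<^sup>2) summable_on UNIV"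
    by (subst summable_on_cong_neutral[where T = "range (\<lambda>\<alpha>. \<alpha> @ [i])"]) auto
qed

lemma fcoeff_right_shift [simp]:
  "fcoeff (right_shift i f) [] = 0"
  "fcoeff (right_shift i f) (\<alpha> @ [j]) = (if j = i then fcoeff f \<alpha> else 0)"
  by (simp_all add: right_shift.rep_eq)

lemma tensor_op_right_creation:
  assumes X: "bounded_linear X"
  shows "((\<lambda>\<phi>. r *\<^sub>R right_creation i \<phi>) \<otimes>\<^sub>O X) f = r *\<^sub>R right_shift i (map_fock X f)"
proof -
  let ?k = "r *\<^sub>R right_shift i (map_fock X f)"
  let ?e = "\<lambda>\<beta>. fock_basis \<beta> \<otimes>\<^sub>F fcoeff ?k \<beta>"
  have 0: "?e \<beta> = 0" if "\<beta> \<notin> range (\<lambda>\<alpha>. \<alpha> @ [i])" for \<beta>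
  proof -
    have "fcoeff ?k \<beta> = 0"
      using that by (cases \<beta> rule: rev_cases) auto
    then show ?thesis by (intro fock_eqI) (simp add: tensor.rep_eq del: fcoeff_simps(5))
  qed
  \<comment> \<open>Only words ending in i contribute to the expansion of the right-hand side;
    reindexing them by their prefix gives the sum defining \<open>tensor_op\<close>.\<close>
  have "(?e has_sum ?k) (range (\<lambda>\<alpha>. \<alpha> @ [i]))"
    by (rule has_sum_cong_neutral[THEN iffD1, OF _ _ _ has_sum_fock_expansion]) (use 0 in auto)
  then have "((?e \<circ> (\<lambda>\<alpha>. \<alpha> @ [i])) has_sum ?k) UNIV"
    by (subst (asm) has_sum_reindex) (auto simp: inj_on_def)
  moreover have "?e \<circ> (\<lambda>\<alpha>. \<alpha> @ [i])
      = (\<lambda>\<alpha>. (r *\<^sub>R right_creation i (fock_basis \<alpha>)) \<otimes>\<^sub>F X (fcoeff f \<alpha>))"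
    by (intro ext fock_eqI)
      (simp add: tensor.rep_eq right_creation_basis fcoeff_map_fock[OF X] fock_basis.rep_eq
        scaleC_of_real[symmetric] scaleC_scaleC scaleC_complex_def)
  ultimately show ?thesis unfolding tensor_op_def by (simp add: infsumI)
qed

section \<open>Radial damping\<close>

definition damp :: "real \<Rightarrow> ('n, 'a::chilbert_space) fock \<Rightarrow> ('n, 'a) fock" where
  "damp r f = Abs_fock (\<lambda>\<alpha>. r ^ length \<alpha> *\<^sub>R fcoeff f \<alpha>)"

lemma fcoeff_damp:
  assumes "0 \<le> r" "r \<le> 1"
  shows "fcoeff (damp r f) \<alpha> = r ^ length \<alpha> *\<^sub>R fcoeff f \<alpha>"
proof -
  have "(\<lambda>\<alpha>. (norm (r ^ length \<alpha> *\<^sub>R fcoeff f \<alpha>))\<^sup>2) summable_on UNIV"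
  proof (rule summable_on_comparison_test[OF coeff_summable[of f]])
    fix \<alpha>
    have "norm (r ^ length \<alpha> *\<^sub>R fcoeff f \<alpha>) \<le> norm (fcoeff f \<alpha>)"
      using assms by (simp add: mult_left_le_one_le power_le_one)
    then show "(norm (r ^ length \<alpha> *\<^sub>R fcoeff f \<alpha>))\<^sup>2 \<le> (norm (fcoeff f \<alpha>))\<^sup>2"
      by (rule power_mono) simp
  qed simp
  then show ?thesis by (simp add: damp_def fcoeff_Abs_fock)
qed

lemma damp_tendsto:
  fixes f :: "('n::finite, 'a::chilbert_space) fock"
  shows "((\<lambda>r. damp r f) \<longlongrightarrow> f) (at_left 1)"
proof (rule tendstoI)
  fix e :: real assume e: "e > 0"
  define q where "q N = (\<Sum>\<alpha>\<in>words_upto N. (norm (fcoeff f \<alpha>))\<^sup>2)" for N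
  define d where "d N r = (\<Sum>\<alpha>\<in>words_upto N. (1 - r ^ length \<alpha>)\<^sup>2 * (norm (fcoeff f \<alpha>))\<^sup>2)"
    for N and r :: real
  have "q \<longlonglongrightarrow> (norm f)\<^sup>2"
    using inner_fock_LIMSEQ[of f f] unfolding q_def power2_norm_eq_inner .
  then have "\<forall>\<^sub>F N in sequentially. q N > (norm f)\<^sup>2 - e\<^sup>2 / 4"
    using e by (intro order_tendstoD) auto
  \<comment> \<open>Outside \<open>words_upto N\<close> the squared norm of f is below e^2/4, and
    damping changes it by no more since (1 - r^k)^2 \<le> 1. Inside, the sum is finite and tends to
    0 as r tends to 1.\<close>
  then obtain N where N: "q N > (norm f)\<^sup>2 - e\<^sup>2 / 4"
    using eventually_happens trivial_limit_sequentially by blast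
  have "(d N \<longlongrightarrow> (\<Sum>\<alpha>\<in>words_upto N. (1 - 1 ^ length \<alpha>)\<^sup>2 * (norm (fcoeff f \<alpha>))\<^sup>2)) (at_left 1)"
    unfolding d_def by (intro tendsto_intros)
  then have "(d N \<longlongrightarrow> 0) (at_left 1)" by simp
  then have "\<forall>\<^sub>F r in at_left 1. d N r < e\<^sup>2 / 4"
    using e by (intro order_tendstoD) auto
  moreover have "\<forall>\<^sub>F r in at_left (1::real). r \<in> {0<..<1}"
    by (rule eventually_at_left_real) simp
  ultimately show "\<forall>\<^sub>F r in at_left 1. dist (damp r f) f < e"
  proof eventually_elim
    case (elim r)
    have r: "0 \<le> r" "r \<le> 1" using elim by auto
    have r1: "(1 - r ^ k)\<^sup>2 \<le> 1" for k
      using r by (intro power_le_one) (auto simp: power_le_one)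
    have coeff: "(norm (fcoeff (damp r f - f) \<alpha>))\<^sup>2
        = (1 - r ^ length \<alpha>)\<^sup>2 * (norm (fcoeff f \<alpha>))\<^sup>2" for \<alpha>
    proof -
      have "fcoeff (damp r f - f) \<alpha> = - ((1 - r ^ length \<alpha>) *\<^sub>R fcoeff f \<alpha>)"
        by (simp add: fcoeff_damp[OF r] scaleR_diff_left)
      then show ?thesis by (simp only: norm_minus_cancel norm_scaleR power_mult_distrib power2_abs)
    qed
    have "(norm (damp r f - f))\<^sup>2 \<le> e\<^sup>2 / 2"
    proof (rule norm_fock_leI)
      fix M
      let ?W = "words_upto (max M N) :: 'n list set"
      let ?D = "?W - words_upto N"
      have sub: "words_upto N \<subseteq> ?W" "words_upto M \<subseteq> ?W" by (auto simp: words_upto_def)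
      have D: "(\<Sum>\<alpha>\<in>?D. (norm (fcoeff f \<alpha>))\<^sup>2) \<le> e\<^sup>2 / 4"
        using sum_diff[OF finite_words_upto sub(1), of "\<lambda>\<alpha>. (norm (fcoeff f \<alpha>))\<^sup>2"]
          sum_norm_fcoeff_le[of f "max M N"] N by (simp add: q_def)
      have "(\<Sum>\<alpha>\<in>words_upto M. (norm (fcoeff (damp r f - f) \<alpha>))\<^sup>2)
          \<le> (\<Sum>\<alpha>\<in>?W. (1 - r ^ length \<alpha>)\<^sup>2 * (norm (fcoeff f \<alpha>))\<^sup>2)"
        unfolding coeff by (intro sum_mono2) (use sub in auto)
      also have "\<dots> = (\<Sum>\<alpha>\<in>?D. (1 - r ^ length \<alpha>)\<^sup>2 * (norm (fcoeff f \<alpha>))\<^sup>2) + d N r"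
        unfolding d_def by (rule sum.subset_diff[OF sub(1)]) simp
      also have "\<dots> \<le> (\<Sum>\<alpha>\<in>?D. (norm (fcoeff f \<alpha>))\<^sup>2) + d N r"
        by (intro add_mono sum_mono order_refl mult_left_le_one_le) (auto intro: r1)
      finally show "(\<Sum>\<alpha>\<in>words_upto M. (norm (fcoeff (damp r f - f) \<alpha>))\<^sup>2) \<le> e\<^sup>2 / 2"
        using D elim by simp
    qed
    also have "\<dots> < e\<^sup>2" using e by simp
    finally show ?case
      unfolding dist_norm using e power2_less_imp_less[of "norm (damp r f - f)" e] by simp
  qed
qed

section \<open>The unitary colligation of a row contraction\<close>

lemma bounded_clinear_compose:
  assumes "bounded_clinear A" "bounded_clinear B"
  shows "bounded_clinear (\<lambda>x. A (B x))"
  using assms unfolding bounded_clinear_def by (auto intro: bounded_linear_compose)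

lemma bounded_clinear_row_op:
  assumes "\<And>i. bounded_clinear (A i)"
  shows "bounded_clinear (row_op A)"
  unfolding bounded_clinear_def
proof (intro conjI allI)
  show "bounded_linear (row_op A)"
    unfolding row_op_def
    by (intro bounded_linear_sum bounded_linear_compose[OF bounded_clinear_bounded_linear[OF assms]]
        bounded_linear_vec_nth)
  show "row_op A (c *\<^sub>C x) = c *\<^sub>C row_op A x" for c x
    by (simp add: row_op_def scaleC_vec_def bounded_clinear_scaleC[OF assms]
        linear_sum[OF bounded_linear.linear[OF bounded_linear_scaleC[of c]]])
qed

lemma cadjoint_row_op:
  assumes "\<And>i. bounded_clinear (A i)"
  shows "cadjoint (row_op A) h = (\<chi> i. cadjoint (A i) h)"
  by (rule cadjoint_eqI[OF bounded_clinear_row_op[OF assms]])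
    (simp add: row_op_def inner_vec_def inner_sum_left inner_cadjoint[OF assms])

lemma diff_mem_closure_range:
  fixes X :: "'a::real_vector \<Rightarrow> 'b::real_normed_vector"
  assumes X: "linear X" and "u \<in> closure (range X)" "v \<in> closure (range X)"
  shows "u - v \<in> closure (range X)"
proof -
  obtain a b where a: "\<And>n. a n \<in> range X" "a \<longlonglongrightarrow> u" and b: "\<And>n. b n \<in> range X" "b \<longlonglongrightarrow> v"
    using assms(2,3) unfolding closure_sequential by blast
  have "a n - b n \<in> range X" for n
    using a(1)[of n] b(1)[of n] by (auto simp: linear_diff[OF X, symmetric])
  then show ?thesis
    unfolding closure_sequential
    by (intro exI[of _ "\<lambda>n. a n - b n"] conjI allI tendsto_diff a(2) b(2))
qed

lemma scaleC_vec_nth: "(c *\<^sub>C v) $ i = c *\<^sub>C v $ i"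
  by (simp add: scaleC_vec_def)

lemma norm_vec_sq: "(norm (v :: 'a::real_inner ^ 'n))\<^sup>2 = (\<Sum>i\<in>UNIV. (norm (v $ i))\<^sup>2)"
  by (simp add: power2_norm_eq_inner inner_vec_def)

locale row_contr =
  fixes T :: "'n::finite \<Rightarrow> 'a::chilbert_space \<Rightarrow> 'a"
  assumes row_contr: "row_contraction T"
begin

abbreviation "R \<equiv> row_op T"
abbreviation "Ra \<equiv> cadjoint (row_op T)"
abbreviation "A \<equiv> defect T"
abbreviation "B \<equiv> defect_star T"

lemma clin_T: "bounded_clinear (T i)"
  using row_contr by (simp add: row_contraction_def)

lemmas clin_R = bounded_clinear_row_op[of T, OF clin_T]
lemmas clin_Ra = bounded_clinear_cadjoint[OF clin_R]

lemma inner_R: "inner (R h) y = inner h (Ra y)"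
  by (rule inner_cadjoint[OF clin_R])

lemma inner_Ra: "inner (Ra y) h = inner y (R h)"
  using inner_R[of h y] by (simp add: inner_commute)

lemma Ra_nth: "Ra h $ i = cadjoint (T i) h"
  by (simp add: cadjoint_row_op[OF clin_T])

lemma norm_Ra_le: "norm (Ra x) \<le> norm x"
proof -
  have "positive_op (\<lambda>x. id x - (R \<circ> Ra) x)"
    using row_contr by (simp add: row_contraction_def op_le_def)
  then have "0 \<le> inner (id x - (R \<circ> Ra) x) x" by (rule positive_op_nonneg)
  then have "(norm (Ra x))\<^sup>2 \<le> (norm x)\<^sup>2"
    by (simp add: inner_diff_left inner_R power2_norm_eq_inner)
  then show ?thesis by (rule power2_le_imp_le) simp
qed

lemma norm_R_le: "norm (R h) \<le> norm h"
proof (cases "R h = 0")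
  case False
  have "norm (R h) * norm (R h) = inner h (Ra (R h))"
    by (simp add: power2_norm_eq_inner inner_R flip: power2_eq_square)
  also have "\<dots> \<le> norm h * norm (R h)"
    by (rule order_trans[OF norm_cauchy_schwarz mult_left_mono[OF norm_Ra_le]]) simp
  finally show ?thesis using False by simp
qed simp

lemma sqrt_setup_left: "sqrt_setup (\<lambda>h. R (Ra h))"
  by unfold_locales
    (auto simp: inner_R inner_Ra intro: bounded_clinear_compose clin_R clin_Ra order_trans[OF norm_R_le norm_Ra_le])

lemma sqrt_setup_right: "sqrt_setup (\<lambda>h. Ra (R h))"
  by unfold_locales
    (auto simp: inner_R inner_Ra intro: bounded_clinear_compose clin_R clin_Ra order_trans[OF norm_Ra_le norm_R_le])

lemma A_eq: "A = sqrt_setup.S (\<lambda>h. R (Ra h))"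
  unfolding defect_def by (rule sqrt_setup.sqrt_op_eq[OF sqrt_setup_left])

lemma B_eq: "B = sqrt_setup.S (\<lambda>h. Ra (R h))"
  unfolding defect_star_def by (rule sqrt_setup.sqrt_op_eq[OF sqrt_setup_right])

lemma clin_A: "bounded_clinear A"
  unfolding A_eq by (rule sqrt_setup.bounded_clinear_S[OF sqrt_setup_left])

lemma clin_B: "bounded_clinear B"
  unfolding B_eq by (rule sqrt_setup.bounded_clinear_S[OF sqrt_setup_right])

lemma A_self_adjoint: "inner (A x) y = inner x (A y)"
  unfolding A_eq by (rule sqrt_setup.S_self_adjoint[OF sqrt_setup_left])

lemma B_self_adjoint: "inner (B x) y = inner x (B y)"
  unfolding B_eq by (rule sqrt_setup.S_self_adjoint[OF sqrt_setup_right])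

lemma A_A: "A (A x) = x - R (Ra x)"
  unfolding A_eq by (rule sqrt_setup.S_S[OF sqrt_setup_left])

lemma B_B: "B (B x) = x - Ra (R x)"
  unfolding B_eq by (rule sqrt_setup.S_S[OF sqrt_setup_right])

text \<open>\<open>Ra\<close> intertwines \<open>R Ra\<close> with \<open>Ra R\<close>, hence also
  the square roots built from them.\<close>

lemma Ra_A: "Ra (A x) = B (Ra x)"
  unfolding A_eq B_eq
  by (rule sqrt_setup_intertwine[OF sqrt_setup_left sqrt_setup_right
        bounded_clinear_bounded_linear[OF clin_Ra]]) simp

lemma R_B: "R (B x) = A (R x)"
  unfolding A_eq B_eq
  by (rule sqrt_setup_intertwine[OF sqrt_setup_right sqrt_setup_left
        bounded_clinear_bounded_linear[OF clin_R]]) simp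

lemmas add_simps =
  linear_add[OF bounded_clinear_linear[OF clin_R]] linear_add[OF bounded_clinear_linear[OF clin_Ra]]
  linear_add[OF bounded_clinear_linear[OF clin_A]] linear_add[OF bounded_clinear_linear[OF clin_B]]
  linear_diff[OF bounded_clinear_linear[OF clin_R]] linear_diff[OF bounded_clinear_linear[OF clin_Ra]]
  linear_diff[OF bounded_clinear_linear[OF clin_A]] linear_diff[OF bounded_clinear_linear[OF clin_B]]

lemmas scaleC_op_simps =
  bounded_clinear_scaleC[OF clin_R] bounded_clinear_scaleC[OF clin_Ra]
  bounded_clinear_scaleC[OF clin_A] bounded_clinear_scaleC[OF clin_B]

lemmas scaleR_op_simps =
  linear_scale[OF bounded_clinear_linear[OF clin_R]] linear_scale[OF bounded_clinear_linear[OF clin_Ra]]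
  linear_scale[OF bounded_clinear_linear[OF clin_A]] linear_scale[OF bounded_clinear_linear[OF clin_B]]

lemmas zero_op_simps [simp] =
  linear_0[OF bounded_clinear_linear[OF clin_R]] linear_0[OF bounded_clinear_linear[OF clin_Ra]]
  linear_0[OF bounded_clinear_linear[OF clin_A]] linear_0[OF bounded_clinear_linear[OF clin_B]]

text \<open>The definitions of the defects give the squared terms. The cross terms cancel because
  \<open>R B = A R\<close>.\<close>

lemma colligation_isometry:
  "(norm (Ra h + B v))\<^sup>2 + (norm (A h - R v))\<^sup>2 = (norm h)\<^sup>2 + (norm v)\<^sup>2"
proof -
  have "inner (Ra h) (Ra h) + inner (A h) (A h) = inner h h"
    by (simp add: inner_Ra A_self_adjoint A_A inner_diff_right)
  moreover have "inner (B v) (B v) + inner (R v) (R v) = inner v v"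
    by (simp add: inner_R B_self_adjoint B_B inner_diff_right)
  moreover have "inner (Ra h) (B v) = inner (A h) (R v)"
    by (simp add: inner_Ra A_self_adjoint R_B)
  ultimately show ?thesis
    by (simp add: power2_norm_eq_inner inner_add inner_diff inner_commute)
qed

text \<open>The colligation as a linear system over the free semigroup: \<open>h\<close> is the initial state, \<open>f\<close> the
  input, and each transition is damped by the factor \<open>r\<close>.\<close>
primrec state :: "real \<Rightarrow> 'a \<Rightarrow> ('n list \<Rightarrow> 'a ^ 'n) \<Rightarrow> 'n list \<Rightarrow> 'a" where
  "state r h f [] = h"
| "state r h f (i # \<alpha>) = state r (r *\<^sub>R (Ra h + B (f [])) $ i) (\<lambda>\<alpha>. f (i # \<alpha>)) \<alpha>"

definition sys_output :: "real \<Rightarrow> 'a \<Rightarrow> ('n list \<Rightarrow> 'a ^ 'n) \<Rightarrow> 'n list \<Rightarrow> 'a" where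
  "sys_output r h f \<alpha> = A (state r h f \<alpha>) - R (f \<alpha>)"

lemma sys_output_Cons:
  "sys_output r h f (i # \<alpha>)
     = sys_output r (r *\<^sub>R (Ra h + B (f [])) $ i) (\<lambda>\<alpha>. f (i # \<alpha>)) \<alpha>"
  by (simp add: sys_output_def)

text \<open>The definition strips the first letter, which suits \<open>left_cut\<close>. Appending a
  last letter is one more transition, which is how right creation acts.\<close>

lemma state_snoc: "state r h f (\<alpha> @ [i]) = r *\<^sub>R (Ra (state r h f \<alpha>) + B (f \<alpha>)) $ i"
  by (induction \<alpha> arbitrary: h f) simp_all

lemma state_add:
  "state r (h + h') (\<lambda>\<alpha>. f \<alpha> + f' \<alpha>) \<alpha> = state r h f \<alpha> + state r h' f' \<alpha>"
proof (induction \<alpha> rule: rev_induct)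
  case (snoc i \<alpha>)
  then show ?case by (simp add: state_snoc add_simps algebra_simps)
qed simp

lemma state_scaleC: "state r (c *\<^sub>C h) (\<lambda>\<alpha>. c *\<^sub>C f \<alpha>) \<alpha> = c *\<^sub>C state r h f \<alpha>"
proof (induction \<alpha> rule: rev_induct)
  case (snoc i \<alpha>)
  have "r *\<^sub>R c *\<^sub>C x = c *\<^sub>C r *\<^sub>R x" for x :: 'a
    by (simp add: scaleC_of_real[symmetric] scaleC_scaleC mult.commute)
  then show ?case
    by (simp add: state_snoc snoc.IH scaleC_op_simps scaleC_vec_nth scaleC_add_right scaleR_add_right)
qed simp

lemma state_damp:
  "state r h (\<lambda>\<alpha>. r ^ length \<alpha> *\<^sub>R f \<alpha>) \<alpha> = r ^ length \<alpha> *\<^sub>R state 1 h f \<alpha>"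
proof (induction \<alpha> rule: rev_induct)
  case (snoc i \<alpha>)
  then show ?case by (simp add: state_snoc scaleR_op_simps algebra_simps)
qed simp

text \<open>By the isometry at the empty word, the output there and the n undamped next states carry
  the energy of the state and the input. The next states start n systems on shorter words; damping,
  and discarding the final states, only lose energy.\<close>

lemma sys_output_energy:
  assumes r: "0 \<le> r" "r \<le> 1"
  shows "(\<Sum>\<alpha>\<in>words_upto N. (norm (sys_output r h f \<alpha>))\<^sup>2)
    \<le> (norm h)\<^sup>2 + (\<Sum>\<alpha>\<in>words_upto N. (norm (f \<alpha>))\<^sup>2)"
proof (induction N arbitrary: h f)
  case 0
  show ?case
    unfolding words_upto_0 sys_output_def colligation_isometry[of h "f []", symmetric]
    by (simp add: colligation_isometry[of h "f []", symmetric])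
next
  case (Suc N)
  let ?v = "Ra h + B (f [])"
  have "(\<Sum>\<alpha>\<in>words_upto (Suc N). (norm (sys_output r h f \<alpha>))\<^sup>2)
      = (norm (A h - R (f [])))\<^sup>2 + (\<Sum>i\<in>UNIV. \<Sum>\<alpha>\<in>words_upto N.
          (norm (sys_output r (r *\<^sub>R ?v $ i) (\<lambda>\<alpha>. f (i # \<alpha>)) \<alpha>))\<^sup>2)"
    unfolding sum_words_upto_Cons sys_output_Cons by (simp add: sys_output_def)
  also have "\<dots> \<le> (norm (A h - R (f [])))\<^sup>2 + (\<Sum>i\<in>UNIV. (norm (?v $ i))\<^sup>2
      + (\<Sum>\<alpha>\<in>words_upto N. (norm (f (i # \<alpha>)))\<^sup>2))"
  proof (intro add_left_mono sum_mono order_trans[OF Suc.IH] add_right_mono)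
    fix i
    have "norm (r *\<^sub>R ?v $ i) \<le> norm (?v $ i)"
      using r mult_left_le_one_le[of "norm (?v $ i)" r] by (simp only: norm_scaleR) simp
    then show "(norm (r *\<^sub>R ?v $ i))\<^sup>2 \<le> (norm (?v $ i))\<^sup>2"
      by (rule power_mono) simp
  qed
  also have "\<dots> = (norm h)\<^sup>2 + (\<Sum>\<alpha>\<in>words_upto (Suc N). (norm (f \<alpha>))\<^sup>2)"
    unfolding sum_words_upto_Cons sum.distrib norm_vec_sq[symmetric]
    using colligation_isometry[of h "f []"] by simp
  finally show ?case .
qed

definition sys_op :: "real \<Rightarrow> 'a \<Rightarrow> ('n, 'a ^ 'n) fock \<Rightarrow> ('n, 'a) fock" where
  "sys_op r h f = Abs_fock (sys_output r h (fcoeff f))"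

lemma
  assumes r: "0 \<le> r" "r \<le> 1"
  shows fcoeff_sys_op: "fcoeff (sys_op r h f) = sys_output r h (fcoeff f)"
    and norm_sys_op_le: "(norm (sys_op r h f))\<^sup>2 \<le> (norm h)\<^sup>2 + (norm f)\<^sup>2"
proof -
  have bound: "(\<Sum>\<alpha>\<in>words_upto N. (norm (sys_output r h (fcoeff f) \<alpha>))\<^sup>2)
      \<le> (norm h)\<^sup>2 + (norm f)\<^sup>2" for N
    by (rule order_trans[OF sys_output_energy[OF r] add_left_mono[OF sum_norm_fcoeff_le]])
  show coeff: "fcoeff (sys_op r h f) = sys_output r h (fcoeff f)"
    unfolding sys_op_def by (rule fcoeff_Abs_fock[OF fock_bounded_summable(1)[OF bound]])
  show "(norm (sys_op r h f))\<^sup>2 \<le> (norm h)\<^sup>2 + (norm f)\<^sup>2"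
    by (rule norm_fock_leI) (simp add: coeff bound)
qed

lemma sys_op_add:
  assumes "0 \<le> r" "r \<le> 1"
  shows "sys_op r (h + h') (f + f') = sys_op r h f + sys_op r h' f'"
  by (rule fock_eqI)
    (simp add: fcoeff_sys_op[OF assms] sys_output_def state_add add_simps plus_fock.rep_eq[abs_def])

lemma sys_op_scaleC:
  assumes "0 \<le> r" "r \<le> 1"
  shows "sys_op r (c *\<^sub>C h) (c *\<^sub>C f) = c *\<^sub>C sys_op r h f"
proof (rule fock_eqI)
  fix \<alpha>
  have "c *\<^sub>C (x - y) = c *\<^sub>C x - c *\<^sub>C y" for x y :: 'a
    by (rule linear_diff[OF bounded_linear.linear[OF bounded_linear_scaleC]])
  then show "fcoeff (sys_op r (c *\<^sub>C h) (c *\<^sub>C f)) \<alpha> = fcoeff (c *\<^sub>C sys_op r h f) \<alpha>"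
    by (simp add: fcoeff_sys_op[OF assms] sys_output_def state_scaleC scaleC_op_simps
        scaleC_fock.rep_eq[abs_def])
qed

text \<open>The notation anticipates \<open>char_fun_eq\<close> and
  \<open>poisson_kernel_eq\<close>, where these operators are identified.\<close>

abbreviation "\<Theta> f \<equiv> sys_op 1 0 f"
abbreviation "K h \<equiv> sys_op 1 h 0"

lemma bounded_clinear_sys_op_input:
  assumes "0 \<le> r" "r \<le> 1"
  shows "bounded_clinear (sys_op r 0)"
proof (rule bounded_clinearI)
  show scale: "sys_op r 0 (c *\<^sub>C f) = c *\<^sub>C sys_op r 0 f" for c f
    using sys_op_scaleC[OF assms, of c 0 f] by simp
  show "linear (sys_op r 0)"
  proof (rule linearI)
    show "sys_op r 0 (f + g) = sys_op r 0 f + sys_op r 0 g" for f g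
      using sys_op_add[OF assms, of 0 0 f g] by simp
    show "sys_op r 0 (s *\<^sub>R f) = s *\<^sub>R sys_op r 0 f" for s f
      using scale[of "complex_of_real s" f] by (simp add: scaleC_of_real)
  qed
  show "norm (sys_op r 0 f) \<le> 1 * norm f" for f
    by (rule power2_le_imp_le) (use norm_sys_op_le[OF assms, of 0 f] in auto)
qed

lemma norm_sys_op_input_le:
  assumes "0 \<le> r" "r \<le> 1"
  shows "norm (sys_op r 0 f) \<le> norm f"
  by (rule power2_le_imp_le) (use norm_sys_op_le[OF assms, of 0 f] in auto)

lemma bounded_clinear_K: "bounded_clinear (\<lambda>h. K h)"
proof (rule bounded_clinearI)
  show scale: "K (c *\<^sub>C h) = c *\<^sub>C K h" for c h
    using sys_op_scaleC[of 1 c h 0] by simp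
  show "linear (\<lambda>h. K h)"
  proof (rule linearI)
    show "K (h + h') = K h + K h'" for h h'
      using sys_op_add[of 1 h h' 0 0] by simp
    show "K (s *\<^sub>R h) = s *\<^sub>R K h" for s h
      using scale[of "complex_of_real s" h] by (simp add: scaleC_of_real)
  qed
  show "norm (K h) \<le> 1 * norm h" for h
    by (rule power2_le_imp_le) (use norm_sys_op_le[of 1 h 0] in auto)
qed

lemmas bounded_clinear_Theta = bounded_clinear_sys_op_input[of 1, simplified]

lemma left_cut_sys_op:
  assumes "0 \<le> r" "r \<le> 1"
  shows "left_cut [i] (sys_op r h f) = sys_op r (r *\<^sub>R (Ra h + B (fcoeff f [])) $ i) (left_cut [i] f)"
  by (rule fock_eqI)
    (simp add: fcoeff_sys_op[OF assms] sys_output_Cons left_cut.rep_eq[abs_def])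

section \<open>Identification of the Poisson kernel and the characteristic function\<close>

lemma word_op_Cons: "word_op T (i # \<alpha>) = (\<lambda>h. T i (word_op T \<alpha> h))"
  by (simp add: word_op_def o_def)

lemma bounded_clinear_word_op: "bounded_clinear (word_op T \<alpha>)"
proof (induction \<alpha>)
  case Nil
  show ?case by (simp add: word_op_def bounded_clinear_def id_def)
next
  case (Cons i \<alpha>)
  then show ?case unfolding word_op_Cons by (rule bounded_clinear_compose[OF clin_T])
qed

text \<open>Adjoints reverse products, so the adjoint of T_i is applied first; this is the
  first-letter recursion of \<open>state\<close>.\<close>

lemma state_eq_cadjoint_word_op: "state 1 h (\<lambda>_. 0) \<alpha> = cadjoint (word_op T \<alpha>) h"
proof (induction \<alpha> arbitrary: h)
  case Nil
  have "cadjoint (word_op T []) h = h"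
    by (rule cadjoint_eqI[OF bounded_clinear_word_op]) (simp add: word_op_def)
  then show ?case by simp
next
  case (Cons i \<alpha>)
  have "cadjoint (word_op T (i # \<alpha>)) h = cadjoint (word_op T \<alpha>) (cadjoint (T i) h)"
    by (rule cadjoint_eqI[OF bounded_clinear_word_op])
      (simp add: word_op_Cons inner_cadjoint[OF clin_T] inner_cadjoint[OF bounded_clinear_word_op])
  then show ?case using Cons by (simp add: Ra_nth)
qed

lemma poisson_kernel_eq: "poisson_kernel T = (\<lambda>h. K h)"
proof
  fix h
  have "fcoeff (K h) \<alpha> = A (cadjoint (word_op T \<alpha>) h)" for \<alpha>
    by (simp add: fcoeff_sys_op sys_output_def state_eq_cadjoint_word_op zero_fock.rep_eq[abs_def])
  then show "poisson_kernel T h = K h"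
    using has_sum_fock_expansion[of "K h"] by (simp add: poisson_kernel_def infsumI)
qed

section \<open>The resolvent and the radial limit\<close>

definition shift_adj :: "real \<Rightarrow> ('n, 'a) fock \<Rightarrow> ('n, 'a) fock" where
  "shift_adj r g = (\<Sum>i\<in>UNIV. r *\<^sub>R right_shift i (map_fock (cadjoint (T i)) g))"

lemma fcoeff_shift_adj:
  "fcoeff (shift_adj r g) [] = 0"
  "fcoeff (shift_adj r g) (\<alpha> @ [i]) = r *\<^sub>R Ra (fcoeff g \<alpha>) $ i"
proof -
  have bl: "bounded_linear (cadjoint (T i))" for i
    by (rule bounded_clinear_bounded_linear[OF bounded_clinear_cadjoint[OF clin_T]])
  show "fcoeff (shift_adj r g) [] = 0"
    by (simp add: shift_adj_def)
  have "fcoeff (shift_adj r g) (\<alpha> @ [i])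
      = (\<Sum>j\<in>UNIV. if i = j then r *\<^sub>R cadjoint (T j) (fcoeff g \<alpha>) else 0)"
    unfolding shift_adj_def fcoeff_sum by (rule sum.cong) (auto simp: fcoeff_map_fock[OF bl])
  then show "fcoeff (shift_adj r g) (\<alpha> @ [i]) = r *\<^sub>R Ra (fcoeff g \<alpha>) $ i"
    by (simp add: Ra_nth)
qed

text \<open>For fixed \<alpha>, the coefficients at the words \<alpha> g_i form the vector r
  \<open>Ra (fcoeff g \<alpha>)\<close>, of norm at most r times that of
  \<open>fcoeff g \<alpha>\<close>.\<close>

lemma norm_shift_adj_le:
  assumes "0 \<le> r"
  shows "norm (shift_adj r g) \<le> r * norm g"
proof (rule power2_le_imp_le)
  have bound: "(\<Sum>\<alpha>\<in>words_upto (Suc N). (norm (fcoeff (shift_adj r g) \<alpha>))\<^sup>2) \<le> (r * norm g)\<^sup>2" for N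
  proof -
    have "(\<Sum>\<alpha>\<in>words_upto (Suc N). (norm (fcoeff (shift_adj r g) \<alpha>))\<^sup>2)
        = (\<Sum>\<alpha>\<in>words_upto N. r\<^sup>2 * (norm (Ra (fcoeff g \<alpha>)))\<^sup>2)"
      unfolding sum_words_upto_snoc fcoeff_shift_adj norm_vec_sq
      by (simp add: power_mult_distrib sum_distrib_left)
    also have "\<dots> \<le> (\<Sum>\<alpha>\<in>words_upto N. r\<^sup>2 * (norm (fcoeff g \<alpha>))\<^sup>2)"
      by (intro sum_mono mult_left_mono power_mono norm_Ra_le) auto
    also have "\<dots> \<le> r\<^sup>2 * (norm g)\<^sup>2"
      unfolding sum_distrib_left[symmetric] by (intro mult_left_mono sum_norm_fcoeff_le) simp
    finally show ?thesis by (simp add: power_mult_distrib)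
  qed
  show "(norm (shift_adj r g))\<^sup>2 \<le> (r * norm g)\<^sup>2"
  proof (rule norm_fock_leI)
    fix N
    have "(\<Sum>\<alpha>\<in>words_upto N. (norm (fcoeff (shift_adj r g) \<alpha>))\<^sup>2)
        \<le> (\<Sum>\<alpha>\<in>words_upto (Suc N). (norm (fcoeff (shift_adj r g) \<alpha>))\<^sup>2)"
      by (intro sum_mono2 words_upto_mono) auto
    then show "(\<Sum>\<alpha>\<in>words_upto N. (norm (fcoeff (shift_adj r g) \<alpha>))\<^sup>2) \<le> (r * norm g)\<^sup>2"
      using bound by (rule order_trans)
  qed
qed (use assms in simp)

text \<open>Solving g = w + \<open>shift_adj r g\<close> is a fixed point problem for a map with
  Lipschitz constant r < 1. Surjectivity makes \<open>inv\<close> a right inverse.\<close>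

lemma surj_resolvent:
  assumes r: "0 \<le> r" "r < 1"
  shows "surj (\<lambda>g. g - shift_adj r g)"
  unfolding surj_def
proof
  fix w
  have diff: "shift_adj r g - shift_adj r g' = shift_adj r (g - g')" for g g'
  proof (rule fock_eqI)
    fix \<alpha> show "fcoeff (shift_adj r g - shift_adj r g') \<alpha> = fcoeff (shift_adj r (g - g')) \<alpha>"
      by (cases \<alpha> rule: rev_cases) (simp_all add: fcoeff_shift_adj add_simps algebra_simps)
  qed
  have "\<exists>!g. w + shift_adj r g = g"
  proof (rule banach_fix_type[OF r])
    show "\<forall>g g'. dist (w + shift_adj r g) (w + shift_adj r g') \<le> r * dist g g'"
      using norm_shift_adj_le[OF r(1)] by (simp add: dist_norm diff)
  qed
  then show "\<exists>g. w = g - shift_adj r g" by (metis add_diff_cancel_right')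
qed

text \<open>The equation solved by the resolvent, read at \<alpha> g_i, is the state recursion with
  input f; at the empty word it gives initial state 0.\<close>

lemma char_fun_r_eq:
  assumes r: "0 \<le> r" "r < 1"
  shows "char_fun_r T r f = sys_op r 0 f"
proof -
  have r1: "r \<le> 1" using r by simp
  have bl: "bounded_linear (cadjoint (T i))" for i
    by (rule bounded_clinear_bounded_linear[OF bounded_clinear_cadjoint[OF clin_T]])
  note blA = bounded_clinear_bounded_linear[OF clin_A]
  note blB = bounded_clinear_bounded_linear[OF clin_B]
  note blR = bounded_clinear_bounded_linear[OF clin_R]
  have blid: "bounded_linear (id :: 'a \<Rightarrow> 'a)" by (simp add: id_def)
  have blnth: "bounded_linear (\<lambda>h :: 'a ^ 'n. h $ i)" for i by (rule bounded_linear_vec_nth)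
  let ?F = "\<lambda>g. g - shift_adj r g"
  let ?w = "row_op (\<lambda>i. (\<lambda>\<phi>. r *\<^sub>R right_creation i \<phi>) \<otimes>\<^sub>O id) (fock_split ((id \<otimes>\<^sub>O B) f))"
  let ?g = "inv ?F ?w"
  have w_eq: "?w = (\<Sum>i\<in>UNIV. r *\<^sub>R right_shift i (map_fock id (map_fock (\<lambda>h. h $ i) (map_fock B f))))"
    by (simp add: row_op_def fock_split_def tensor_op_id[OF blB] tensor_op_id[OF blnth]
        tensor_op_right_creation[OF blid])
  have w0: "fcoeff ?w [] = 0" unfolding w_eq by simp
  have w1: "fcoeff ?w (\<alpha> @ [i]) = r *\<^sub>R B (fcoeff f \<alpha>) $ i" for \<alpha> i
  proof -
    have "fcoeff ?w (\<alpha> @ [i]) = (\<Sum>j\<in>UNIV. if i = j then r *\<^sub>R B (fcoeff f \<alpha>) $ j else 0)"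
      unfolding w_eq fcoeff_sum
      by (rule sum.cong) (auto simp: fcoeff_map_fock[OF blB] fcoeff_map_fock[OF blnth]
          fcoeff_map_fock[OF blid])
    then show ?thesis by simp
  qed
  have g: "?g - shift_adj r ?g = ?w"
    using surj_f_inv_f[OF surj_resolvent[OF r]] .
  then have g': "?g = ?w + shift_adj r ?g" by (simp add: algebra_simps)
  have st: "fcoeff ?g \<alpha> = state r 0 (fcoeff f) \<alpha>" for \<alpha>
  proof (induction \<alpha> rule: rev_induct)
    case Nil
    show ?case by (subst g') (simp add: w0 fcoeff_shift_adj )
  next
    case (snoc i \<alpha>)
    show ?case
      by (subst g') (simp add: w1 fcoeff_shift_adj snoc.IH state_snoc algebra_simps)
  qed
  have "char_fun_r T r f = - map_fock R f + map_fock A ?g"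
    unfolding char_fun_r_def Let_def tensor_op_right_creation[OF bl] tensor_op_id[OF blR]
      tensor_op_id[OF blA] shift_adj_def[symmetric] ..
  then show ?thesis
    by (intro fock_eqI)
      (simp add: fcoeff_sys_op[OF r(1) r1] sys_output_def fcoeff_map_fock[OF blA]
        fcoeff_map_fock[OF blR] st)
qed

lemma sys_op_damp:
  assumes "0 \<le> r" "r \<le> 1"
  shows "sys_op r 0 (damp r f) = damp r (\<Theta> f)"
proof (rule fock_eqI)
  fix \<alpha>
  have "fcoeff (damp r f) = (\<lambda>\<alpha>. r ^ length \<alpha> *\<^sub>R fcoeff f \<alpha>)"
    by (rule ext) (rule fcoeff_damp[OF assms])
  then show "fcoeff (sys_op r 0 (damp r f)) \<alpha> = fcoeff (damp r (\<Theta> f)) \<alpha>"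
    by (simp add: fcoeff_sys_op[OF assms] fcoeff_damp[OF assms] fcoeff_sys_op sys_output_def
        state_damp scaleR_op_simps scaleR_diff_right)
qed

text \<open>With D_r the damping and \<Theta>_r the damped system, \<Theta>_r f - \<Theta> f =
  \<Theta>_r (f - D_r f) + (D_r \<Theta> f - \<Theta> f). Both terms vanish in the limit because
  every \<Theta>_r is a contraction.\<close>

lemma char_fun_eq: "char_fun T f = \<Theta> f"
proof -
  have "((\<lambda>r. norm (f - damp r f) + norm (damp r (\<Theta> f) - \<Theta> f)) \<longlongrightarrow> norm (f - f) + norm (\<Theta> f - \<Theta> f))
      (at_left 1)"
    by (intro tendsto_intros damp_tendsto)
  then have lim: "((\<lambda>r. norm (f - damp r f) + norm (damp r (\<Theta> f) - \<Theta> f)) \<longlongrightarrow> 0) (at_left 1)"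
    by simp
  have "\<forall>\<^sub>F r in at_left (1::real). r \<in> {0<..<1}"
    by (rule eventually_at_left_real) simp
  then have "\<forall>\<^sub>F r in at_left 1. norm (char_fun_r T r f - \<Theta> f)
      \<le> norm (f - damp r f) + norm (damp r (\<Theta> f) - \<Theta> f)"
  proof eventually_elim
    case (elim r)
    then have r: "0 \<le> r" "r \<le> 1" "r < 1" by auto
    have "char_fun_r T r f - \<Theta> f = sys_op r 0 (f - damp r f) + (damp r (\<Theta> f) - \<Theta> f)"
      by (simp add: char_fun_r_eq[OF r(1,3)] sys_op_damp[OF r(1,2)]
          linear_diff[OF bounded_clinear_linear[OF bounded_clinear_sys_op_input[OF r(1,2)]]])
    then show ?case
      using norm_sys_op_input_le[OF r(1,2), of "f - damp r f"]
      by (simp only: norm_triangle_le add_right_mono)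
  qed
  then have "((\<lambda>r. char_fun_r T r f - \<Theta> f) \<longlongrightarrow> 0) (at_left 1)"
    by (rule Lim_null_comparison[OF _ lim])
  then have "((\<lambda>r. char_fun_r T r f) \<longlongrightarrow> \<Theta> f) (at_left 1)" by (rule LIM_zero_cancel)
  then show ?thesis
    unfolding char_fun_def by (intro tendsto_Lim) simp_all
qed

section \<open>The adjoint system\<close>

text \<open>The state at \<beta> of the adjoint system, which runs backwards: it collects the part
  of y on words beginning with \<beta>.\<close>

definition costate :: "('n, 'a) fock \<Rightarrow> 'n list \<Rightarrow> 'a" where
  "costate y \<beta> = cadjoint (\<lambda>h. K h) (left_cut \<beta> y)"

lemma inner_K: "inner (K h) (left_cut \<beta> y) = inner h (costate y \<beta>)"
  unfolding costate_def by (rule inner_cadjoint[OF bounded_clinear_K])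

abbreviation next_costate :: "('n, 'a) fock \<Rightarrow> 'n list \<Rightarrow> 'a ^ 'n" where
  "next_costate y \<beta> \<equiv> (\<chi> i. costate y (\<beta> @ [i]))"

text \<open>The state component of the adjoint colligation. It comes from pairing with K h, whose
  cut at the letter i is K applied to \<open>Ra h $ i\<close>.\<close>

lemma costate_eq: "costate y \<beta> = R (next_costate y \<beta>) + A (fcoeff y \<beta>)"
proof (rule eq_if_inner_eq)
  fix h
  have "left_cut [i] 0 = (0 :: ('n, 'a ^ 'n) fock)" for i
    by (rule fock_eqI) simp
  then have cut: "left_cut [i] (K h) = K (Ra h $ i)" for i
    by (simp add: left_cut_sys_op)
  have "inner h (costate y \<beta>) = inner (A h) (fcoeff y \<beta>)
      + (\<Sum>i\<in>UNIV. inner (Ra h $ i) (costate y (\<beta> @ [i])))"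
    unfolding inner_K[symmetric] inner_fock_Cons[of "K h"] cut left_cut_left_cut
    by (simp add: fcoeff_sys_op sys_output_def)
  then show "inner h (costate y \<beta>) = inner h (R (next_costate y \<beta>) + A (fcoeff y \<beta>))"
    by (simp add: inner_add_right inner_Ra[symmetric] A_self_adjoint inner_vec_def)
qed

abbreviation "\<Theta>a \<equiv> cadjoint (sys_op 1 0)"

text \<open>Causality and shift invariance: started at 0, the system stays at 0 until the input
  begins at \<beta>. This is commutation with left creation.\<close>

lemma left_cut_Theta:
  assumes "\<And>\<alpha>. (\<nexists>\<gamma>. \<alpha> = \<beta> @ \<gamma>) \<Longrightarrow> fcoeff f \<alpha> = 0"
  shows "left_cut \<beta> (\<Theta> f) = \<Theta> (left_cut \<beta> f)"
  using assms
proof (induction \<beta> arbitrary: f)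
  case (Cons i \<beta>)
  have "fcoeff f [] = 0" by (rule Cons.prems) simp
  then have "left_cut [i] (\<Theta> f) = \<Theta> (left_cut [i] f)"
    by (simp add: left_cut_sys_op)
  moreover have "left_cut \<beta> (\<Theta> (left_cut [i] f)) = \<Theta> (left_cut \<beta> (left_cut [i] f))"
    by (rule Cons.IH) (auto intro: Cons.prems)
  ultimately show ?case
    using left_cut_left_cut[of \<beta> "[i]" "\<Theta> f"] left_cut_left_cut[of \<beta> "[i]" f] by simp
qed simp

lemma fcoeff_Theta_eq_0:
  assumes "\<And>\<alpha>. (\<nexists>\<gamma>. \<alpha> = \<beta> @ \<gamma>) \<Longrightarrow> fcoeff f \<alpha> = 0" "\<nexists>\<gamma>. \<alpha> = \<beta> @ \<gamma>"
  shows "fcoeff (\<Theta> f) \<alpha> = 0"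
proof -
  have "state 1 0 (fcoeff f) \<alpha> = 0" if "\<nexists>\<gamma>. \<alpha> = \<beta> @ \<gamma>" for \<alpha>
    using that
  proof (induction \<alpha> rule: rev_induct)
    case (snoc i \<alpha>)
    then have "\<nexists>\<gamma>. \<alpha> = \<beta> @ \<gamma>" by (metis append.assoc)
    then show ?case using snoc.IH assms(1) by (simp add: state_snoc)
  qed simp
  then show ?thesis using assms by (simp add: fcoeff_sys_op sys_output_def)
qed

text \<open>The input component of the adjoint colligation. The test input v at \<beta> is moved to
  the empty word; its response is - \<open>R v\<close> there, and after the letter i it is K applied
  to \<open>B v $ i\<close>.\<close>

lemma fcoeff_Theta_adj:
  "fcoeff (\<Theta>a y) \<beta> = B (next_costate y \<beta>) - Ra (fcoeff y \<beta>)"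
proof (rule eq_if_inner_eq)
  fix v :: "'a ^ 'n"
  let ?f = "single_fock \<beta> v"
  let ?e = "single_fock [] v :: ('n, 'a ^ 'n) fock"
  have supp: "fcoeff ?f \<alpha> = 0" if "\<nexists>\<gamma>. \<alpha> = \<beta> @ \<gamma>" for \<alpha>
    using that by auto
  have "left_cut [i] ?e = 0" for i by (rule fock_eqI) simp
  then have cut: "left_cut [i] (\<Theta> ?e) = K (B v $ i)" for i
    by (simp add: left_cut_sys_op)
  have "inner v (fcoeff (\<Theta>a y) \<beta>) = inner (\<Theta> ?f) y"
    unfolding inner_cadjoint[OF bounded_clinear_Theta] by (simp add: inner_single_fock)
  also have "\<dots> = inner (left_cut \<beta> (\<Theta> ?f)) (left_cut \<beta> y)"
    by (rule inner_left_cut) (rule fcoeff_Theta_eq_0[OF supp])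
  also have "left_cut \<beta> (\<Theta> ?f) = \<Theta> ?e"
    using left_cut_Theta[OF supp] by (simp add: left_cut_single_fock)
  also have "inner (\<Theta> ?e) (left_cut \<beta> y) = inner (- R v) (fcoeff y \<beta>)
      + (\<Sum>i\<in>UNIV. inner (B v $ i) (costate y (\<beta> @ [i])))"
    unfolding inner_fock_Cons[of "\<Theta> ?e"] cut left_cut_left_cut inner_K
    by (simp add: fcoeff_sys_op sys_output_def)
  also have "\<dots> = inner v (B (next_costate y \<beta>) - Ra (fcoeff y \<beta>))"
    by (simp add: inner_diff_right inner_R B_self_adjoint[symmetric] inner_vec_def[of "B v"])
  finally show "inner v (fcoeff (\<Theta>a y) \<beta>) = inner v (B (next_costate y \<beta>) - Ra (fcoeff y \<beta>))" .
qed

text \<open>Fed with the input \<open>\<Theta>\<^sup>* y\<close> and the initial state \<open>K\<^sup>* y\<close>, the system runs through the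
  costates and reproduces \<open>y\<close>, because the colligation is also coisometric.\<close>
lemma sys_op_Theta_adj: "sys_op 1 (costate y []) (\<Theta>a y) = y"
proof (rule fock_eqI)
  fix \<beta>
  have "state 1 (costate y []) (fcoeff (\<Theta>a y)) \<beta> = costate y \<beta>"
  proof (induction \<beta> rule: rev_induct)
    case (snoc i \<beta>)
    \<comment> \<open>The terms in \<open>fcoeff y \<beta>\<close> cancel by \<open>Ra_A\<close>,
      and those in the next costates add up by \<open>B_B\<close>.\<close>
    have "Ra (costate y \<beta>) + B (fcoeff (\<Theta>a y) \<beta>) = next_costate y \<beta>"
      unfolding costate_eq[of y \<beta>] fcoeff_Theta_adj by (simp add: add_simps Ra_A B_B)
    then show ?case by (simp add: state_snoc snoc.IH)
  qed simp
  moreover have "A (costate y \<beta>) - R (fcoeff (\<Theta>a y) \<beta>) = fcoeff y \<beta>"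
    unfolding costate_eq[of y \<beta>] fcoeff_Theta_adj by (simp add: add_simps R_B A_A)
  ultimately show "fcoeff (sys_op 1 (costate y []) (\<Theta>a y)) \<beta> = fcoeff y \<beta>"
    by (simp add: fcoeff_sys_op sys_output_def)
qed

lemma Theta_Theta_adj: "y - \<Theta> (\<Theta>a y) = K (cadjoint (\<lambda>h. K h) y)"
proof -
  have "sys_op 1 (costate y [] + 0) (0 + \<Theta>a y) = K (costate y []) + \<Theta> (\<Theta>a y)"
    by (rule sys_op_add) simp_all
  then have "y = K (costate y []) + \<Theta> (\<Theta>a y)" by (simp add: sys_op_Theta_adj)
  then show ?thesis by (simp add: costate_def algebra_simps)
qed

section \<open>Restriction to the defect spaces\<close>

text \<open>By \<open>Ra A = B Ra\<close> and continuity, \<open>Ra\<close> maps the closed range of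
  \<open>A\<close> into that of \<open>B\<close>; the other summand of the coefficient lies in the
  range of \<open>B\<close>.\<close>

lemma Theta_adj_mem:
  assumes "y \<in> fock_over (defect_space T)"
  shows "\<Theta>a y \<in> fock_over (defect_star_space T)"
  unfolding fock_over_def defect_star_space_def
proof safe
  fix \<beta>
  have "fcoeff y \<beta> \<in> closure (range A)"
    using assms by (simp add: fock_over_def defect_space_def)
  moreover have "Ra ` closure (range A) \<subseteq> closure (range B)"
    by (rule image_closure_subset[OF linear_continuous_on[OF bounded_clinear_bounded_linear[OF clin_Ra]]
          closed_closure]) (auto simp: Ra_A intro: closure_subset[THEN subsetD])
  ultimately have "Ra (fcoeff y \<beta>) \<in> closure (range B)" by blast
  moreover have "B (next_costate y \<beta>) \<in> closure (range B)"
    by (rule closure_subset[THEN subsetD]) simp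
  ultimately show "fcoeff (\<Theta>a y) \<beta> \<in> closure (range B)"
    unfolding fcoeff_Theta_adj using diff_mem_closure_range[OF bounded_clinear_linear[OF clin_B]] by blast
qed

text \<open>The adjoint on the whole space already takes its value in the subspace, so it satisfies
  the description of the adjoint of the restriction.\<close>

lemma char_fun_adj_eq:
  assumes "y \<in> fock_over (defect_space T)"
  shows "char_fun_adj T y = \<Theta>a y"
  unfolding char_fun_adj_def
proof (rule cadjoint_on_eqI[OF Theta_adj_mem[OF assms]])
  show "cinner (char_fun T z) y = cinner z (\<Theta>a y)" for z
    unfolding char_fun_eq by (rule cinner_cadjoint[OF bounded_clinear_Theta])
  show "u - v \<in> fock_over (defect_star_space T)"
    if "u \<in> fock_over (defect_star_space T)" "v \<in> fock_over (defect_star_space T)" for u v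
    using that diff_mem_closure_range[OF bounded_clinear_linear[OF clin_B]]
    by (simp add: fock_over_def defect_star_space_def)
qed

end

theorem theorem3p2:
  fixes T :: "'n::finite \<Rightarrow> 'a::chilbert_space \<Rightarrow> 'a"
  assumes "row_contraction T"
  shows "\<forall>f \<in> fock_over (defect_space T).
           f - char_fun T (char_fun_adj T f) = poisson_kernel T (cadjoint (poisson_kernel T) f)"
proof
  interpret row_contr T by unfold_locales (rule assms)
  fix f :: "('n, 'a) fock" assume "f \<in> fock_over (defect_space T)"
  then show "f - char_fun T (char_fun_adj T f) = poisson_kernel T (cadjoint (poisson_kernel T) f)"
    by (simp add: char_fun_adj_eq char_fun_eq poisson_kernel_eq Theta_Theta_adj)
qed

end
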